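(* Let $(\widetilde V_n)_{n\ge 0}$ and $(\widetilde u_n)_{n\ge 0}$ be any sequences of reduced spaces and reduced solutions generated by the globally coupled online enrichment algorithm (described in the context), and let $u\in V$ be the exact solution. Then for every $n\ge 0$ $$\|u-\widetilde u_{n+1}\|_a=\min_{i=1,\dots,N_D}\ \min_{\psi_e\in O_i}\Big\{\|u-\widetilde u_e\|_a\ \Big|\ \widetilde u_e\in\widetilde V_n+\operatorname{span}\{\psi_e\}\ \text{solves}\ a(\widetilde u_e,\varphi)=f(\varphi)\ \ \forall\varphi\in\widetilde V_n+\operatorname{span}\{\psi_e\}\Big\}.$$
   Context: Setting. Let $\Omega\subset\mathbb R^d$, $d\in\{2,3\}$, be a bounded domain, $\kappa:\Omega\to\mathbb R$ a measurable heat conductivity with $0<\kappa_{min}\le\kappa\le\kappa_{max}<\infty$ a.e., and $f\in L^2(\Omega)$. Let $V:=H^1_0(\Omega)$, $a(v,\varphi):=\int_\Omega \kappa\,\nabla v\cdot\nabla\varphi\,dx$, and $f(\varphi):=\int_\Omega f\varphi\,dx$. The exact solution $u\in V$ is the unique element with $a(u,\varphi)=f(\varphi)$ for all $\varphi\in V$. The energy norm is $\|v\|_a:=\sqrt{a(v,v)}$. Let $\omega_1,\dots,\omega_{N_D}$ be open subdomains of $\Omega$ (an overlapping domain decomposition) with $\bigcup_{i=1}^{N_D}\omega_i=\Omega$. Put $O_i:=H^1_0(\omega_i)$, regarded as a subspace of $V$ by extension by zero and equipped with the energy inner product and norm. Globally coupled online enrichment algorithm. Start with $\widetilde V_0:=\{0\}$.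 For $n=0,1,2,\dots$: 1. Let $\widetilde u_n\in\widetilde V_n$ be the unique solution of $a(\widetilde u_n,\varphi)=f(\varphi)$ for all $\varphi\in\widetilde V_n$. 2. For each $i=1,\dots,N_D$ let $\widehat u_{n,i}\in\widetilde V_n+O_i$ be the unique solution of $a(\widehat u_{n,i},\varphi)=f(\varphi)$ for all $\varphi\in\widetilde V_n+O_i$. 3. Choose $k\in\{1,\dots,N_D\}$ maximizing $\|\widetilde u_n-\widehat u_{n,i}\|_a$ over $i=1,\dots,N_D$ (any maximizer). 4. Set $\widetilde V_{n+1}:=\widetilde V_n+\operatorname{span}\{\widehat u_{n,k}\}$. The stopping criterion is ignored, so the iteration is defined for all $n\ge 0$. (Sums of subspaces are not required to be direct.) *)

theory Defs
  imports "HOL-Analysis.Analysis" "HOL-Library.Function_Algebras" "HOL-Library.Set_Algebras"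
begin

text \<open>
  Elements of the Lebesgue and Sobolev spaces below are represented by functions, and two functions
  that agree almost everywhere represent the same element. The pointwise vector space structure on
  functions makes \<^const>\<open>span\<close> and the sum of subspaces available.
\<close>

instantiation "fun" :: (type, real_vector) real_vector
begin

definition scaleR_fun :: "real \<Rightarrow> ('a \<Rightarrow> 'b) \<Rightarrow> 'a \<Rightarrow> 'b"
  where "scaleR_fun c v = (\<lambda>x. c *\<^sub>R v x)"

instance
  by standard (auto simp: scaleR_fun_def scaleR_add_right scaleR_add_left)

end

definition partial :: "'n \<Rightarrow> (real ^ 'n \<Rightarrow> real) \<Rightarrow> real ^ 'n \<Rightarrow> real"
  where "partial j \<phi> x = frechet_derivative \<phi> (at x) (axis j 1)"

primrec C_k :: "nat \<Rightarrow> (real ^ 'n \<Rightarrow> real) \<Rightarrow> bool"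
  where
    "C_k 0 \<phi> \<longleftrightarrow> continuous_on UNIV \<phi>"
  | "C_k (Suc k) \<phi> \<longleftrightarrow> (\<forall>x. \<phi> differentiable (at x)) \<and> (\<forall>j. C_k k (partial j \<phi>))"

definition test_functions :: "(real ^ 'n) set \<Rightarrow> (real ^ 'n \<Rightarrow> real) set"
  where "test_functions \<Omega> =
    {\<phi>. (\<forall>k. C_k k \<phi>) \<and> compact (closure {x. \<phi> x \<noteq> 0}) \<and> closure {x. \<phi> x \<noteq> 0} \<subseteq> \<Omega>}"

definition L2 :: "(real ^ 'n) set \<Rightarrow> (real ^ 'n \<Rightarrow> real) set"
  where "L2 \<Omega> =
    {v. v \<in> borel_measurable (lebesgue_on \<Omega>) \<and> integrable (lebesgue_on \<Omega>) (\<lambda>x. (v x)\<^sup>2)}"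

definition is_weak_gradient ::
    "(real ^ 'n) set \<Rightarrow> (real ^ 'n \<Rightarrow> real) \<Rightarrow> (real ^ 'n \<Rightarrow> real ^ 'n) \<Rightarrow> bool"
  where "is_weak_gradient \<Omega> v g \<longleftrightarrow>
    (\<forall>j. (\<lambda>x. g x $ j) \<in> L2 \<Omega> \<and>
      (\<forall>\<phi>\<in>test_functions \<Omega>.
        (LINT x|lebesgue_on \<Omega>. v x * partial j \<phi> x) = - (LINT x|lebesgue_on \<Omega>. g x $ j * \<phi> x)))"

definition H1 :: "(real ^ 'n) set \<Rightarrow> (real ^ 'n \<Rightarrow> real) set"
  where "H1 \<Omega> = {v \<in> L2 \<Omega>. \<exists>g. is_weak_gradient \<Omega> v g}"

text \<open>For open \<open>\<Omega>\<close> the weak gradient of a function in \<open>H1 \<Omega>\<close> is unique up to null sets, and it is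
  only used under integrals over \<open>\<Omega>\<close>.\<close>

definition weak_gradient :: "(real ^ 'n) set \<Rightarrow> (real ^ 'n \<Rightarrow> real) \<Rightarrow> real ^ 'n \<Rightarrow> real ^ 'n"
  where "weak_gradient \<Omega> v = (SOME g. is_weak_gradient \<Omega> v g)"

definition H1_norm :: "(real ^ 'n) set \<Rightarrow> (real ^ 'n \<Rightarrow> real) \<Rightarrow> real"
  where "H1_norm \<Omega> v =
    sqrt ((LINT x|lebesgue_on \<Omega>. (v x)\<^sup>2) + (LINT x|lebesgue_on \<Omega>. (norm (weak_gradient \<Omega> v x))\<^sup>2))"

text \<open>The closure of the test functions in \<open>H1 \<Omega>\<close>.\<close>

definition H10 :: "(real ^ 'n) set \<Rightarrow> (real ^ 'n \<Rightarrow> real) set"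
  where "H10 \<Omega> =
    {v \<in> H1 \<Omega>. \<exists>\<phi> :: nat \<Rightarrow> real ^ 'n \<Rightarrow> real.
      (\<forall>m. \<phi> m \<in> test_functions \<Omega>) \<and> (\<lambda>m. H1_norm \<Omega> (v - \<phi> m)) \<longlonglongrightarrow> 0}"

definition zero_extension :: "(real ^ 'n) set \<Rightarrow> (real ^ 'n \<Rightarrow> real) \<Rightarrow> real ^ 'n \<Rightarrow> real"
  where "zero_extension \<omega> v = (\<lambda>x. if x \<in> \<omega> then v x else 0)"

definition local_space :: "(real ^ 'n) set \<Rightarrow> (real ^ 'n \<Rightarrow> real) set"
  where "local_space \<omega> = zero_extension \<omega> ` H10 \<omega>"

definition energy_form ::
    "(real ^ 'n) set \<Rightarrow> (real ^ 'n \<Rightarrow> real) \<Rightarrow> (real ^ 'n \<Rightarrow> real) \<Rightarrow> (real ^ 'n \<Rightarrow> real) \<Rightarrow> real"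
  where "energy_form \<Omega> \<kappa> v \<phi> =
    (LINT x|lebesgue_on \<Omega>. \<kappa> x * (weak_gradient \<Omega> v x \<bullet> weak_gradient \<Omega> \<phi> x))"

definition energy_norm ::
    "(real ^ 'n) set \<Rightarrow> (real ^ 'n \<Rightarrow> real) \<Rightarrow> (real ^ 'n \<Rightarrow> real) \<Rightarrow> real"
  where "energy_norm \<Omega> \<kappa> v = sqrt (energy_form \<Omega> \<kappa> v v)"

definition load :: "(real ^ 'n) set \<Rightarrow> (real ^ 'n \<Rightarrow> real) \<Rightarrow> (real ^ 'n \<Rightarrow> real) \<Rightarrow> real"
  where "load \<Omega> f \<phi> = (LINT x|lebesgue_on \<Omega>. f x * \<phi> x)"

text \<open>Solutions of the variational problem posed on a subspace \<open>W\<close>. Uniqueness (up to null sets) is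
  a consequence of coercivity and is not part of the definition.\<close>

definition solves ::
    "(real ^ 'n) set \<Rightarrow> (real ^ 'n \<Rightarrow> real) \<Rightarrow> (real ^ 'n \<Rightarrow> real) \<Rightarrow>
      (real ^ 'n \<Rightarrow> real) set \<Rightarrow> (real ^ 'n \<Rightarrow> real) \<Rightarrow> bool"
  where "solves \<Omega> \<kappa> f W w \<longleftrightarrow> w \<in> W \<and> (\<forall>\<phi>\<in>W. energy_form \<Omega> \<kappa> w \<phi> = load \<Omega> f \<phi>)"

text \<open>\<open>Vt\<close> and \<open>ut\<close> are the reduced spaces and reduced solutions of some run of the globally coupled
  online enrichment algorithm on the subdomains \<open>\<omega> 1, \<dots>, \<omega> N\<close>; \<open>uh i\<close> are the locally enriched
  solutions of step \<open>n\<close>, and \<open>k\<close> may be any maximizer.\<close>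

definition online_enrichment ::
    "(real ^ 'n) set \<Rightarrow> (real ^ 'n \<Rightarrow> real) \<Rightarrow> (real ^ 'n \<Rightarrow> real) \<Rightarrow> nat \<Rightarrow> (nat \<Rightarrow> (real ^ 'n) set) \<Rightarrow>
      (nat \<Rightarrow> (real ^ 'n \<Rightarrow> real) set) \<Rightarrow> (nat \<Rightarrow> real ^ 'n \<Rightarrow> real) \<Rightarrow> bool"
  where "online_enrichment \<Omega> \<kappa> f N \<omega> Vt ut \<longleftrightarrow>
    Vt 0 = {0} \<and>
    (\<forall>n. solves \<Omega> \<kappa> f (Vt n) (ut n) \<and>
      (\<exists>uh k.
        (\<forall>i\<in>{1..N}. solves \<Omega> \<kappa> f (Vt n + local_space (\<omega> i)) (uh i)) \<and>
        k \<in> {1..N} \<and>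
        (\<forall>i\<in>{1..N}. energy_norm \<Omega> \<kappa> (ut n - uh i) \<le> energy_norm \<Omega> \<kappa> (ut n - uh k)) \<and>
        Vt (Suc n) = Vt n + span {uh k}))"

definition is_minimum :: "real set \<Rightarrow> real \<Rightarrow> bool"
  where "is_minimum S m \<longleftrightarrow> m \<in> S \<and> (\<forall>s\<in>S. m \<le> s)"

end

theory Submission imports Defs begin

text \<open>
  In every subspace of \<open>V = H10 \<Omega>\<close> the Galerkin solution is a best approximation of \<open>u\<close> in the energy
  norm, by orthogonality of the error (\<open>Galerkin_pythagoras\<close>, \<open>Galerkin_best_approximation\<close>). Fix \<open>i\<close> and
  let \<open>uh i\<close> be the Galerkin solution in \<open>W i = Vt n + local_space (\<omega> i)\<close>. For every \<open>\<psi>\<close> in the local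
  space, \<open>Vt n + span {\<psi>}\<close> is contained in \<open>W i\<close>, so no single enrichment beats \<open>uh i\<close>. Conversely
  write \<open>uh i = v + \<psi>\<close> with \<open>v\<close> in \<open>Vt n\<close> and \<open>\<psi>\<close> in the local space: enriching by this \<open>\<psi>\<close> puts \<open>uh i\<close>
  into the space and attains its error. The inner minimum is therefore the error of \<open>uh i\<close>.

  As \<open>ut n\<close> lies in every \<open>W i\<close>, Pythagoras splits the squared error of \<open>ut n\<close> into the squared error of
  \<open>uh i\<close> and the squared distance of \<open>ut n\<close> and \<open>uh i\<close>. Hence the index \<open>k\<close> that maximizes the distance
  minimizes the error. Finally \<open>Vt (Suc n)\<close> contains \<open>uh k\<close> and is contained in \<open>W k\<close>, so the error of
  \<open>ut (Suc n)\<close> is the error of \<open>uh k\<close>.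

  The analytic content lies in two facts. First, the energy form is a positive semidefinite bilinear
  form on \<open>V\<close> (\<open>semi_inner_product_energy_form\<close>). As \<open>weak_gradient\<close> chooses one of many representatives,
  its additivity needs uniqueness almost everywhere, that is, the fundamental lemma of the calculus
  of variations, for which smooth bumps on boxes are constructed. Second, the local spaces are
  subspaces of \<open>V\<close> (\<open>local_space_subset_H10\<close>). This rests on integration by parts for test functions,
  which follows from translation invariance of Lebesgue measure.
\<close>

section \<open>Smooth bump functions on boxes\<close>

text \<open>One-variable smoothness as the existence of \<open>k\<close> successive derivatives. In contrast to
  \<^const>\<open>C_k\<close> the derivatives are existentially quantified, so products and chains are handled by
  exhibiting a derivative.\<close>

primrec diff_k :: "nat \<Rightarrow> (real \<Rightarrow> real) \<Rightarrow> bool"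
  where
    "diff_k 0 f \<longleftrightarrow> True"
  | "diff_k (Suc k) f \<longleftrightarrow> (\<exists>f'. (\<forall>x. (f has_real_derivative f' x) (at x)) \<and> diff_k k f')"

lemma diff_k_SucI:
  assumes "\<And>x. (f has_real_derivative f' x) (at x)" "diff_k k f'"
  shows "diff_k (Suc k) f"
  using assms by auto

lemma diff_k_Suc_imp: "diff_k (Suc k) f \<Longrightarrow> diff_k k f"
  by (induction k arbitrary: f) auto

lemma diff_k_add: "diff_k k f \<Longrightarrow> diff_k k g \<Longrightarrow> diff_k k (\<lambda>x. f x + g x)"
proof (induction k arbitrary: f g)
  case (Suc k)
  from Suc.prems obtain f' g' where
    d: "\<And>x. (f has_real_derivative f' x) (at x)" "\<And>x. (g has_real_derivative g' x) (at x)"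
    and k: "diff_k k f'" "diff_k k g'" by auto
  show ?case
    by (rule diff_k_SucI[OF DERIV_add[OF d] Suc.IH[OF k]])
qed simp

lemma diff_k_const: "diff_k k (\<lambda>x. c)"
proof (induction k arbitrary: c)
  case (Suc k)
  show ?case by (rule diff_k_SucI[OF _ Suc.IH[of 0]]) simp
qed simp

lemma diff_k_mult: "diff_k k f \<Longrightarrow> diff_k k g \<Longrightarrow> diff_k k (\<lambda>x. f x * g x)"
proof (induction k arbitrary: f g)
  case (Suc k)
  from Suc.prems obtain f' g' where
    d: "\<And>x. (f has_real_derivative f' x) (at x)" "\<And>x. (g has_real_derivative g' x) (at x)"
    and k: "diff_k k f'" "diff_k k g'" by auto
  have "diff_k k (\<lambda>x. f' x * g x + g' x * f x)"
    by (rule diff_k_add[OF Suc.IH[OF k(1) diff_k_Suc_imp[OF Suc.prems(2)]]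
          Suc.IH[OF k(2) diff_k_Suc_imp[OF Suc.prems(1)]]])
  then show ?case
    by (rule diff_k_SucI[OF DERIV_mult[OF d]])
qed simp

lemma diff_k_affine: "diff_k k f \<Longrightarrow> diff_k k (\<lambda>t. f (m * t + c))"
proof (induction k arbitrary: f)
  case (Suc k)
  from Suc.prems obtain f' where
    d: "\<And>x. (f has_real_derivative f' x) (at x)" and k: "diff_k k f'" by auto
  have "((\<lambda>t. f (m * t + c)) has_real_derivative f' (m * t + c) * m) (at t)" for t
    by (rule DERIV_chain2[where f=f and g="\<lambda>t. m * t + c", OF d])
      (auto intro!: derivative_eq_intros)
  moreover have "diff_k k (\<lambda>t. f' (m * t + c) * m)"
    by (rule diff_k_mult[OF Suc.IH[OF k] diff_k_const])
  ultimately show ?case by (rule diff_k_SucI)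
qed simp

text \<open>The functions \<open>exp (- 1 / t) / t ^ n\<close>, extended by \<open>0\<close> to \<open>t \<le> 0\<close>. The whole family is needed because
  the derivative of a member is a combination of two others; this makes the smoothness of each of
  them an immediate induction.\<close>

definition flat_exp :: "nat \<Rightarrow> real \<Rightarrow> real"
  where "flat_exp n t = (if 0 < t then inverse t ^ n * exp (- inverse t) else 0)"

text \<open>With \<open>y = 1 / t\<close> this is \<open>y\<^sup>n / exp y \<longlonglongrightarrow> 0\<close>.\<close>

lemma flat_exp_tendsto_0: "((\<lambda>t. flat_exp n t) \<longlongrightarrow> 0) (at 0)"
proof -
  have "((\<lambda>t::real. inverse t ^ n / exp (inverse t)) \<longlongrightarrow> 0) (at_right 0)"
    by (rule filterlim_compose[OF tendsto_power_div_exp_0 filterlim_inverse_at_top_right])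
  then have "(flat_exp n \<longlongrightarrow> 0) (at_right 0)"
    by (rule Lim_transform_eventually)
      (auto simp: flat_exp_def exp_minus field_simps eventually_at_right_less intro!: eventually_at_rightI[of 0 1])
  moreover have "(flat_exp n \<longlongrightarrow> 0) (at_left 0)"
    by (rule tendsto_eventually) (auto simp: flat_exp_def intro!: eventually_at_leftI[of "-1"])
  ultimately show ?thesis
    by (simp add: filterlim_split_at)
qed

lemma flat_exp_has_derivative:
  "(flat_exp n has_real_derivative flat_exp (n + 2) t - real n * flat_exp (n + 1) t) (at t)"
proof -
  consider "t > 0" | "t < 0" | "t = 0" by linarith
  then show ?thesis
  proof cases
    case 1
    have "((\<lambda>t. inverse t ^ n * exp (- inverse t)) has_real_derivative
        flat_exp (n + 2) t - real n * flat_exp (n + 1) t) (at t)"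
    proof (rule DERIV_cong)
      show "((\<lambda>t. inverse t ^ n * exp (- inverse t)) has_real_derivative
          real n * (inverse t ^ (n - 1) * - (inverse t)\<^sup>2) * exp (- inverse t)
          + exp (- inverse t) * (inverse t)\<^sup>2 * inverse t ^ n) (at t)"
        using 1 by (intro DERIV_mult) (auto intro!: derivative_eq_intros simp: power2_eq_square)
    qed (use 1 in \<open>cases n; simp add: flat_exp_def algebra_simps power2_eq_square\<close>)
    then show ?thesis
      by (rule DERIV_cong_ev[OF refl _ refl, THEN iffD1, rotated])
        (use 1 in \<open>auto simp: flat_exp_def eventually_nhds intro!: exI[of _ "{0<..}"]\<close>)
  next
    case 2
    have "((\<lambda>t. 0) has_real_derivative flat_exp (n + 2) t - real n * flat_exp (n + 1) t) (at t)"
      using 2 by (auto simp: flat_exp_def)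
    then show ?thesis
      by (rule DERIV_cong_ev[OF refl _ refl, THEN iffD1, rotated])
        (use 2 in \<open>auto simp: flat_exp_def eventually_nhds intro!: exI[of _ "{..<0}"]\<close>)
  next
    case 3
    \<comment> \<open>The difference quotient of the \<open>n\<close>-th function at \<open>0\<close> is the next function of the family.\<close>
    have "((\<lambda>h. flat_exp (Suc n) h) \<longlongrightarrow> 0) (at 0)" by (rule flat_exp_tendsto_0)
    then have "((\<lambda>h. (flat_exp n (0 + h) - flat_exp n 0) / h) \<longlongrightarrow> 0) (at 0)"
      by (rule Lim_transform_eventually) (auto simp: flat_exp_def field_simps intro!: always_eventually)
    then show ?thesis using 3 by (simp add: DERIV_def flat_exp_def)
  qed
qed

lemma diff_k_flat_exp: "diff_k k (flat_exp n)"
proof (induction k arbitrary: n)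
  case (Suc k)
  have "diff_k k (\<lambda>t. flat_exp (n + 2) t + (- real n) * flat_exp (n + 1) t)"
    by (rule diff_k_add[OF Suc.IH diff_k_mult[OF diff_k_const Suc.IH]])
  then show ?case
    by (intro diff_k_SucI[OF flat_exp_has_derivative]) simp
qed simp

lemma partial_eqI: "(\<phi> has_derivative D) (at x) \<Longrightarrow> partial j \<phi> x = D (axis j 1)"
  unfolding partial_def using frechet_derivative_at by metis

text \<open>A partial derivative of a tensor product is again a tensor product, with one factor
  differentiated, so the claim reproduces itself under \<^const>\<open>partial\<close>. The extra derivative in the
  hypothesis provides continuity of the factors in the base case.\<close>

lemma C_k_tensor:
  assumes "\<And>i. diff_k (Suc k) (G i)"
  shows "C_k k (\<lambda>x :: real ^ 'n. \<Prod>i\<in>UNIV. G i (x $ i))"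
  using assms
proof (induction k arbitrary: G)
  case 0
  then obtain G' where G': "\<And>i x. (G i has_real_derivative G' i x) (at x)" by simp metis
  then have "continuous_on UNIV (G i)" for i
    by (meson DERIV_isCont continuous_at_imp_continuous_on)
  then show ?case
    by (auto intro!: continuous_on_prod continuous_intros
        intro: continuous_on_compose2[of UNIV "G i" UNIV "\<lambda>x. x $ i" for i])
next
  case (Suc k)
  then have "\<forall>i. \<exists>G'. (\<forall>x. (G i has_real_derivative G' x) (at x)) \<and> diff_k (Suc k) G'" by simp
  then obtain G' where
    G': "\<And>i x. (G i has_real_derivative G' i x) (at x)" and k: "\<And>i. diff_k (Suc k) (G' i)" by metis
  have d: "((\<lambda>x :: real ^ 'n. \<Prod>i\<in>UNIV. G i (x $ i)) has_derivative
     (\<lambda>y. \<Sum>i\<in>UNIV. G' i (x $ i) * y $ i * (\<Prod>j\<in>UNIV - {i}. G j (x $ j)))) (at x)" for x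
  proof (rule has_derivative_prod)
    fix i :: 'n
    show "((\<lambda>x :: real ^ 'n. G i (x $ i)) has_derivative (\<lambda>y. G' i (x $ i) * y $ i)) (at x)"
      by (rule has_derivative_compose[OF bounded_linear_imp_has_derivative[OF bounded_linear_vec_nth]
          G'[unfolded has_field_derivative_def]])
  qed
  have "partial j (\<lambda>x :: real ^ 'n. \<Prod>i\<in>UNIV. G i (x $ i)) =
      (\<lambda>x. \<Prod>i\<in>UNIV. (G(j := G' j)) i (x $ i))" for j
  proof
    fix x :: "real ^ 'n"
    have "partial j (\<lambda>x :: real ^ 'n. \<Prod>i\<in>UNIV. G i (x $ i)) x =
        (\<Sum>i\<in>UNIV. if i = j then G' j (x $ j) * (\<Prod>i\<in>UNIV - {j}. G i (x $ i)) else 0)"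
      unfolding partial_eqI[OF d] by (intro sum.cong) (auto simp: axis_def)
    also have "\<dots> = G' j (x $ j) * (\<Prod>i\<in>UNIV - {j}. G i (x $ i))" by simp
    also have "\<dots> = (\<Prod>i\<in>UNIV. (G(j := G' j)) i (x $ i))"
      by (subst (2) prod.remove[of _ j]) (auto intro!: prod.cong)
    finally show "partial j (\<lambda>x :: real ^ 'n. \<Prod>i\<in>UNIV. G i (x $ i)) x = \<dots>" .
  qed
  moreover have "C_k k (\<lambda>x :: real ^ 'n. \<Prod>i\<in>UNIV. (G(j := G' j)) i (x $ i))" for j
    by (rule Suc.IH) (use k diff_k_Suc_imp Suc.prems in \<open>auto simp del: diff_k.simps(2)\<close>)
  ultimately show ?case
    using d by (auto simp: differentiable_def)
qed

text \<open>Since \<open>flat_exp 0 (m c) = exp (- 1 / (m c))\<close> tends to \<open>1\<close> for every \<open>c > 0\<close>, scaling the argument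
  rather than mollifying yields test functions that converge pointwise to the indicator of an open box.\<close>

definition box_bump :: "real ^ 'n \<Rightarrow> real ^ 'n \<Rightarrow> nat \<Rightarrow> real ^ 'n \<Rightarrow> real"
  where "box_bump a b m x =
    (\<Prod>i\<in>UNIV. flat_exp 0 (real m * (x $ i - a $ i)) * flat_exp 0 (real m * (b $ i - x $ i)))"

lemma C_k_box_bump: "C_k k (box_bump a b m :: real ^ 'n \<Rightarrow> real)"
proof -
  have "diff_k (Suc k) (\<lambda>t. flat_exp 0 (real m * t + - (real m * a $ i))
      * flat_exp 0 (- real m * t + real m * b $ i))" for i
    by (rule diff_k_mult[OF diff_k_affine[OF diff_k_flat_exp] diff_k_affine[OF diff_k_flat_exp]])
  from C_k_tensor[OF this] show ?thesis
    by (simp add: box_bump_def[abs_def] algebra_simps)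
qed

lemma box_bump_eq_0: "x \<notin> box a b \<Longrightarrow> box_bump a b m x = 0"
  unfolding box_bump_def mem_box_cart
  by (rule prod_zero) (auto simp: flat_exp_def zero_less_mult_iff)

lemma box_bump_bounded: "\<bar>box_bump a b m x\<bar> \<le> 1"
  unfolding box_bump_def abs_prod
  by (intro prod_le_1) (auto simp: flat_exp_def abs_mult simp del: inverse_mult_distrib intro!: mult_le_one)

lemma box_bump_tendsto: "(\<lambda>m. box_bump a b m x) \<longlonglongrightarrow> indicator (box a b) x"
proof (cases "x \<in> box a b")
  case True
  have "(\<lambda>m. flat_exp 0 (real m * c)) \<longlonglongrightarrow> 1" if "c > 0" for c
  proof -
    have "(\<lambda>m. exp (- (inverse (real m) * inverse c))) \<longlonglongrightarrow> exp (- (0 * inverse c))"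
      by (intro tendsto_intros lim_inverse_n)
    moreover have "\<forall>\<^sub>F m in sequentially. exp (- (inverse (real m) * inverse c)) = flat_exp 0 (real m * c)"
      using that by (auto simp: flat_exp_def intro!: eventually_sequentiallyI[of 1])
    ultimately show ?thesis
      using Lim_transform_eventually by fastforce
  qed
  then have "(\<lambda>m. box_bump a b m x) \<longlonglongrightarrow> (\<Prod>i\<in>(UNIV::'a set). 1 * 1)"
    unfolding box_bump_def using True by (intro tendsto_prod tendsto_mult) (auto simp: mem_box_cart)
  then show ?thesis using True by simp
qed (simp add: box_bump_eq_0)

lemma box_bump_test_function:
  assumes "cbox a b \<subseteq> \<Omega>"
  shows "box_bump a b m \<in> test_functions \<Omega>"
proof -
  have "closure {x. box_bump a b m x \<noteq> 0} \<subseteq> cbox a b"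
    using box_bump_eq_0 box_subset_cbox by (intro closure_minimal) (auto, blast)
  moreover from this have "compact (closure {x. box_bump a b m x \<noteq> 0})"
    by (meson closed_closure bounded_cbox bounded_subset compact_eq_bounded_closed)
  ultimately show ?thesis
    using assms C_k_box_bump by (auto simp: test_functions_def)
qed

section \<open>Square integrable functions\<close>

lemma L2_D:
  assumes "v \<in> L2 S"
  shows "v \<in> borel_measurable (lebesgue_on S)" "integrable (lebesgue_on S) (\<lambda>x. (v x)\<^sup>2)"
  using assms by (auto simp: L2_def)

lemma L2_mult_integrable:
  assumes "v \<in> L2 S" "w \<in> L2 S"
  shows "integrable (lebesgue_on S) (\<lambda>x. v x * w x)"
proof (rule Bochner_Integration.integrable_bound)
  show "integrable (lebesgue_on S) (\<lambda>x. (v x)\<^sup>2 + (w x)\<^sup>2)"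
    using assms by (auto simp: L2_def)
  show "(\<lambda>x. v x * w x) \<in> borel_measurable (lebesgue_on S)"
    using L2_D(1)[OF assms(1)] L2_D(1)[OF assms(2)] by measurable
  have "\<bar>r * s\<bar> \<le> r\<^sup>2 + s\<^sup>2" for r s :: real
    using sum_squares_bound[of "\<bar>r\<bar>" "\<bar>s\<bar>"] mult_nonneg_nonneg[OF abs_ge_zero[of r] abs_ge_zero[of s]]
    unfolding abs_mult power2_abs by linarith
  then show "AE x in lebesgue_on S. norm (v x * w x) \<le> norm ((v x)\<^sup>2 + (w x)\<^sup>2)"
    by (simp add: real_norm_def)
qed

lemma subspace_L2: "subspace (L2 S)"
proof (rule subspaceI)
  show "0 \<in> L2 S" by (simp add: L2_def zero_fun_def)
  show "v + w \<in> L2 S" if "v \<in> L2 S" "w \<in> L2 S" for v w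
  proof -
    have "integrable (lebesgue_on S) (\<lambda>x. (v x)\<^sup>2 + (w x)\<^sup>2 + 2 * (v x * w x))"
      using L2_mult_integrable[OF that] that by (auto simp: L2_def)
    moreover have "v + w \<in> borel_measurable (lebesgue_on S)"
      using L2_D(1)[OF that(1)] L2_D(1)[OF that(2)] by (simp add: plus_fun_def)
    ultimately show ?thesis
      by (simp add: L2_def plus_fun_def power2_sum algebra_simps)
  qed
  show "c *\<^sub>R v \<in> L2 S" if "v \<in> L2 S" for c v
    using that by (auto simp: L2_def scaleR_fun_def power_mult_distrib)
qed

lemma L2_add: "v \<in> L2 S \<Longrightarrow> w \<in> L2 S \<Longrightarrow> (\<lambda>x. v x + w x) \<in> L2 S"
  using subspace_add[OF subspace_L2, of v S w] by (simp add: plus_fun_def)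

lemma L2_scale: "v \<in> L2 S \<Longrightarrow> (\<lambda>x. c * v x) \<in> L2 S"
  using subspace_scale[OF subspace_L2, of v S c] by (simp add: scaleR_fun_def)

lemma L2_diff: "v \<in> L2 S \<Longrightarrow> w \<in> L2 S \<Longrightarrow> (\<lambda>x. v x - w x) \<in> L2 S"
  using L2_add[OF _ L2_scale[of w S "-1"]] by simp

text \<open>The quadratic \<open>t \<mapsto> \<integral> (t v + w)\<^sup>2\<close> is nonnegative.\<close>

lemma L2_Cauchy_Schwarz:
  assumes "v \<in> L2 S" "w \<in> L2 S"
  shows "\<bar>LINT x|lebesgue_on S. v x * w x\<bar> \<le>
    sqrt (LINT x|lebesgue_on S. (v x)\<^sup>2) * sqrt (LINT x|lebesgue_on S. (w x)\<^sup>2)"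
proof -
  define B where "B = (LINT x|lebesgue_on S. v x * w x)"
  define A where "A = (LINT x|lebesgue_on S. (v x)\<^sup>2)"
  define C where "C = (LINT x|lebesgue_on S. (w x)\<^sup>2)"
  have nn: "A \<ge> 0" "C \<ge> 0" by (auto simp: A_def C_def)
  have quad: "0 \<le> A * t\<^sup>2 + 2 * t * B + C" for t
  proof -
    have "0 \<le> (LINT x|lebesgue_on S. (t * v x + w x)\<^sup>2)" by simp
    also have "\<dots> = (LINT x|lebesgue_on S. t\<^sup>2 * (v x)\<^sup>2 + 2 * t * (v x * w x) + (w x)\<^sup>2)"
      by (simp add: power2_sum power_mult_distrib algebra_simps)
    also have "\<dots> = t\<^sup>2 * A + 2 * t * B + C"
      using L2_mult_integrable[OF assms] L2_D(2)[OF assms(1)] L2_D(2)[OF assms(2)]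
      by (simp add: A_def B_def C_def)
    finally show ?thesis by (simp add: algebra_simps)
  qed
  \<comment> \<open>For \<open>A \<noteq> 0\<close> evaluate at the minimizer \<open>- B / A\<close>; for \<open>A = 0\<close> the quadratic is affine, and it is nonnegative only if its slope vanishes.\<close>
  have "B\<^sup>2 \<le> A * C"
  proof (cases "A = 0")
    case True
    have "B = 0"
      using quad[of "- (C + 1) / (2 * B)"] True by (cases "B = 0") (auto simp: field_simps)
    then show ?thesis using nn by simp
  next
    case False
    then show ?thesis
      using quad[of "- B / A"] nn by (simp add: field_simps power2_eq_square)
  qed
  then have "\<bar>B\<bar> \<le> sqrt (A * C)" by (simp add: real_le_rsqrt)
  then show ?thesis by (simp add: A_def B_def C_def real_sqrt_mult)
qed

text \<open>Local and global integrals are compared through extension by zero: both sides become integrals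
  over the whole space of the same function.\<close>

lemma zero_extension_lebesgue_on:
  fixes v :: "real ^ 'n \<Rightarrow> real"
  assumes "\<omega> \<in> sets lebesgue" "\<Omega> \<in> sets lebesgue" "\<omega> \<subseteq> \<Omega>"
  shows "zero_extension \<omega> v \<in> borel_measurable (lebesgue_on \<Omega>) \<longleftrightarrow> v \<in> borel_measurable (lebesgue_on \<omega>)"
    and "integrable (lebesgue_on \<Omega>) (zero_extension \<omega> v) \<longleftrightarrow> integrable (lebesgue_on \<omega>) v"
    and "(LINT x|lebesgue_on \<Omega>. zero_extension \<omega> v x) = (LINT x|lebesgue_on \<omega>. v x)"
proof -
  have eq: "(\<lambda>x. indicator \<Omega> x *\<^sub>R zero_extension \<omega> v x) = (\<lambda>x. indicator \<omega> x *\<^sub>R v x)"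
    using assms(3) by (auto simp: zero_extension_def indicator_def fun_eq_iff)
  show "zero_extension \<omega> v \<in> borel_measurable (lebesgue_on \<Omega>) \<longleftrightarrow> v \<in> borel_measurable (lebesgue_on \<omega>)"
    unfolding zero_extension_def using borel_measurable_if_lebesgue_on[OF assms] .
  show "integrable (lebesgue_on \<Omega>) (zero_extension \<omega> v) \<longleftrightarrow> integrable (lebesgue_on \<omega>) v"
    using assms by (simp add: integrable_restrict_space eq del: real_scaleR_def)
  show "(LINT x|lebesgue_on \<Omega>. zero_extension \<omega> v x) = (LINT x|lebesgue_on \<omega>. v x)"
    using assms by (simp add: integral_restrict_space eq del: real_scaleR_def)
qed

lemma zero_extension_mult: "zero_extension \<omega> v x * w x = zero_extension \<omega> (\<lambda>x. v x * w x) x"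
  and zero_extension_power2: "(zero_extension \<omega> v x)\<^sup>2 = zero_extension \<omega> (\<lambda>x. (v x)\<^sup>2) x"
  by (auto simp: zero_extension_def)

lemma L2_zero_extension_iff:
  assumes "\<omega> \<in> sets lebesgue" "\<Omega> \<in> sets lebesgue" "\<omega> \<subseteq> \<Omega>"
  shows "zero_extension \<omega> v \<in> L2 \<Omega> \<longleftrightarrow> v \<in> L2 \<omega>"
  using zero_extension_lebesgue_on[OF assms] by (simp add: L2_def zero_extension_power2)

lemma L2_continuous_compact_support:
  fixes v :: "real ^ 'n \<Rightarrow> real"
  assumes "continuous_on UNIV v" "compact K" "\<And>x. x \<notin> K \<Longrightarrow> v x = 0" "S \<in> sets lebesgue"
  shows "v \<in> L2 S"
proof -
  have K: "K \<in> sets lebesgue" using assms(2) by (simp add: borel_compact)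
  have meas: "v \<in> borel_measurable (lebesgue_on S)"
    using assms(1,4) by (meson continuous_imp_measurable_on_sets_lebesgue continuous_on_subset subset_UNIV)
  have "continuous_on K (\<lambda>x. (v x)\<^sup>2)"
    by (intro continuous_intros continuous_on_subset[OF assms(1)]) auto
  then have "integrable lborel (\<lambda>x. indicator K x *\<^sub>R (v x)\<^sup>2)"
    by (rule borel_integrable_compact[OF assms(2)])
  moreover have "(\<lambda>x. indicator K x *\<^sub>R (v x)\<^sup>2) = (\<lambda>x. (v x)\<^sup>2)"
    using assms(3) by (auto simp: indicator_def fun_eq_iff)
  ultimately have "integrable lborel (\<lambda>x. (v x)\<^sup>2)" by simp
  then have "integrable lebesgue (\<lambda>x. (v x)\<^sup>2)"
    by (subst integrable_completion) auto
  then show ?thesis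
    using assms(4) meas integrable_mult_indicator[of S lebesgue "\<lambda>x. (v x)\<^sup>2"]
    by (auto simp: L2_def integrable_restrict_space)
qed

section \<open>Uniqueness of the weak gradient\<close>

text \<open>Dominated convergence along the bumps of the box; \<open>\<bar>g\<bar>\<close> times the indicator of the closed box is an
  integrable majorant because \<open>g\<close> is square integrable and the box is bounded.\<close>

lemma integral_box_eq_0:
  fixes g :: "real ^ 'n \<Rightarrow> real"
  assumes "open \<Omega>" "g \<in> L2 \<Omega>" "cbox a b \<subseteq> \<Omega>"
    and orth: "\<And>\<phi>. \<phi> \<in> test_functions \<Omega> \<Longrightarrow> (LINT x|lebesgue_on \<Omega>. g x * \<phi> x) = 0"
  shows "(LINT x|lebesgue_on \<Omega>. g x * indicator (box a b) x) = 0"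
    and "integrable (lebesgue_on \<Omega>) (\<lambda>x. g x * indicator (box a b) x)"
proof -
  have \<Omega>: "\<Omega> \<in> sets lebesgue" using assms(1) by auto
  note [measurable] = L2_D(1)[OF assms(2)]
  have "(indicator (cbox a b) :: real ^ 'n \<Rightarrow> real) \<in> borel_measurable lebesgue"
    by (rule borel_measurable_indicator) simp
  moreover have "(\<lambda>x. indicator \<Omega> x *\<^sub>R (indicator (cbox a b) x)\<^sup>2) = (indicator (cbox a b) :: _ \<Rightarrow> real)"
    using assms(3) by (auto simp: indicator_def fun_eq_iff)
  ultimately have ind: "(indicator (cbox a b) :: real ^ 'n \<Rightarrow> real) \<in> L2 \<Omega>"
    using \<Omega> unfolding L2_def
    by (auto simp: integrable_restrict_space measurable_restrict_space1 integrable_indicator_iff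
        emeasure_lborel_cbox_finite[unfolded infinity_ennreal_def] simp del: real_scaleR_def)
  have dom: "integrable (lebesgue_on \<Omega>) (\<lambda>x. \<bar>g x * indicator (cbox a b) x\<bar>)"
    using L2_mult_integrable[OF assms(2) ind] by simp
  have bump: "box_bump a b m \<in> borel_measurable (lebesgue_on \<Omega>)" for m
    using C_k_box_bump[of 0 a b m] \<Omega>
    by (auto intro: continuous_imp_measurable_on_sets_lebesgue continuous_on_subset)
  have boxm: "(indicator (box a b) :: real ^ 'n \<Rightarrow> real) \<in> borel_measurable (lebesgue_on \<Omega>)"
    by (intro measurable_restrict_space1 borel_measurable_indicator) simp
  note m = boxm bump
  have lim: "AE x in lebesgue_on \<Omega>. (\<lambda>m. g x * box_bump a b m x) \<longlonglongrightarrow> g x * indicator (box a b) x"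
    by (intro AE_I2 tendsto_intros box_bump_tendsto)
  have bd: "norm (g x * box_bump a b m x) \<le> \<bar>g x * indicator (cbox a b) x\<bar>" for m x
  proof (cases "x \<in> cbox a b")
    case True
    then show ?thesis
      using mult_left_mono[OF box_bump_bounded[of a b m x], of "\<bar>g x\<bar>"] by (simp add: abs_mult)
  next
    case False
    then have "x \<notin> box a b" using box_subset_cbox by blast
    then show ?thesis by (simp add: box_bump_eq_0)
  qed
  have meas: "(\<lambda>x. g x * indicator (box a b) x) \<in> borel_measurable (lebesgue_on \<Omega>)"
    "\<And>m. (\<lambda>x. g x * box_bump a b m x) \<in> borel_measurable (lebesgue_on \<Omega>)"
    using m by measurable
  note dct = meas dom lim AE_I2[OF bd]
  have "(\<lambda>m. LINT x|lebesgue_on \<Omega>. g x * box_bump a b m x) \<longlonglongrightarrow>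
      (LINT x|lebesgue_on \<Omega>. g x * indicator (box a b) x)"
    by (rule integral_dominated_convergence[OF dct])
  moreover have "(LINT x|lebesgue_on \<Omega>. g x * box_bump a b m x) = 0" for m
    by (intro orth box_bump_test_function assms(3))
  ultimately show "(LINT x|lebesgue_on \<Omega>. g x * indicator (box a b) x) = 0"
    by (simp add: LIMSEQ_const_iff)
  show "integrable (lebesgue_on \<Omega>) (\<lambda>x. g x * indicator (box a b) x)"
    by (rule integrable_dominated_convergence[OF dct])
qed

text \<open>The open boxes are an intersection stable generator of the Borel sets, so the integral of \<open>h\<close>
  vanishes on all Borel sets, and then on all Lebesgue sets, which are Borel up to a null set.\<close>

lemma AE_eq_0_if_integral_boxes_eq_0:
  fixes h :: "real ^ 'n \<Rightarrow> real"
  assumes h: "integrable lebesgue h"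
    and boxes: "\<And>c d. (LINT x|lebesgue. indicator (box c d) x * h x) = 0"
    and total: "(LINT x|lebesgue. h x) = 0"
  shows "AE x in lebesgue. h x = 0"
proof (rule density_unique_real[OF h])
  show "integrable lebesgue (\<lambda>_. 0 :: real)" by simp
  note [measurable] = borel_measurable_integrable[OF h]
  have int: "set_integrable lebesgue A h" if "A \<in> sets lebesgue" for A
    using integrable_mult_indicator[OF that h] by (simp add: set_integrable_def)
  have borel: "set_lebesgue_integral lebesgue A h = 0" if A: "A \<in> sets borel" for A
  proof -
    have "Int_stable (range (\<lambda>(a, b). box a b :: (real ^ 'n) set))"
      by (auto simp: Int_stable_def box_Int_box)
    moreover have "range (\<lambda>(a, b). box a b :: (real ^ 'n) set) \<subseteq> Pow UNIV" by simp
    moreover have "A \<in> sigma_sets UNIV (range (\<lambda>(a, b). box a b))"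
      using A unfolding borel_eq_box by simp
    ultimately show ?thesis
    proof (induction rule: sigma_sets_induct_disjoint)
      case (basic A)
      then show ?case using boxes by (auto simp: set_lebesgue_integral_def)
    next
      case empty
      show ?case by (simp add: set_lebesgue_integral_def)
    next
      case (compl A)
      then have "A \<in> sets borel" by (simp add: borel_eq_box)
      then have "A \<in> sets lebesgue" by simp
      then have "set_lebesgue_integral lebesgue UNIV h =
          set_lebesgue_integral lebesgue A h + set_lebesgue_integral lebesgue (UNIV - A) h"
        using set_integral_Un[of A "UNIV - A" lebesgue h] int[of A] int[of "UNIV - A"]
          sets.compl_sets[of A lebesgue] by simp
      then show ?case
        using compl.IH total by (simp add: set_lebesgue_integral_def)
    next
      case (union A)
      then have "A i \<in> sets borel" for i by (auto simp: borel_eq_box)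
      then have A: "A i \<in> sets lebesgue" for i by simp
      have "set_lebesgue_integral lebesgue (\<Union>i. A i) h = (\<Sum>i. set_lebesgue_integral lebesgue (A i) h)"
        by (rule lebesgue_integral_countable_add)
          (use A union.hyps in \<open>auto intro!: int simp: disjoint_family_on_def\<close>)
      then show ?case using union.IH by simp
    qed
  qed
  fix A :: "(real ^ 'n) set"
  assume A: "A \<in> sets lebesgue"
  obtain S N N' where S: "A = S \<union> N" "N \<subseteq> N'" "N' \<in> null_sets lborel" "S \<in> sets lborel"
    by (rule sets_completionE[OF A])
  have "S \<in> sets lebesgue" using S(4) by simp
  note [measurable] = this A
  have "AE x in lebesgue. x \<notin> N'"
    using S(3) by (intro AE_completion AE_not_in)
  then have "set_lebesgue_integral lebesgue A h = set_lebesgue_integral lebesgue S h"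
    unfolding set_lebesgue_integral_def
    using S A by (intro integral_cong_AE) (auto elim!: eventually_mono split: split_indicator)
  then show "set_lebesgue_integral lebesgue A h = (\<integral>x \<in> A. 0 \<partial>lebesgue)"
    using borel S(4) by simp
qed

text \<open>Orthogonality to the test functions gives zero integrals over all boxes inside \<open>\<Omega>\<close>. The function
  vanishes almost everywhere on each closed box contained in \<open>\<Omega>\<close>, and countably many of them
  exhaust \<open>\<Omega>\<close>.\<close>

lemma fundamental_lemma_calculus_of_variations:
  fixes g :: "real ^ 'n \<Rightarrow> real"
  assumes "open \<Omega>" "g \<in> L2 \<Omega>"
    and orth: "\<And>\<phi>. \<phi> \<in> test_functions \<Omega> \<Longrightarrow> (LINT x|lebesgue_on \<Omega>. g x * \<phi> x) = 0"
  shows "AE x in lebesgue_on \<Omega>. g x = 0"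
proof -
  have \<Omega>: "\<Omega> \<in> sets lebesgue" using assms(1) by auto
  have on_box: "AE x in lebesgue. x \<in> cbox a b \<longrightarrow> g x = 0" if ab: "cbox a b \<subseteq> \<Omega>" for a b
  proof -
    have restr: "(\<lambda>x. indicator \<Omega> x *\<^sub>R (g x * indicator (box c d) x)) =
        (\<lambda>x. indicator (box c d) x * g x)" if "box c d \<subseteq> \<Omega>" for c d
      using that by (auto simp: indicator_def fun_eq_iff)
    have zero: "(LINT x|lebesgue. indicator (box c d) x * g x) = 0"
      "integrable lebesgue (\<lambda>x. indicator (box c d) x * g x)" if cd: "cbox c d \<subseteq> \<Omega>" for c d
      using integral_box_eq_0[OF assms(1,2) cd orth] restr[of c d] cd box_subset_cbox[of c d] \<Omega>
      by (auto simp: integral_restrict_space integrable_restrict_space)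
    have "AE x in lebesgue. indicator (box a b) x * g x = 0"
    proof (rule AE_eq_0_if_integral_boxes_eq_0)
      show "integrable lebesgue (\<lambda>x. indicator (box a b) x * g x)"
        "(LINT x|lebesgue. indicator (box a b) x * g x) = 0"
        by (fact zero[OF ab])+
      fix c d :: "real ^ 'n"
      obtain p q where pq: "box c d \<inter> box a b = box p q"
        using box_Int_box by blast
      have pq2: "cbox p q \<subseteq> cbox a b" if "box p q \<noteq> {}"
      proof -
        have "box p q \<subseteq> cbox a b" using pq box_subset_cbox by blast
        from closure_minimal[OF this closed_cbox] show ?thesis using closure_box[OF that] by simp
      qed
      have "(\<lambda>x. indicator (box c d) x * (indicator (box a b) x * g x)) =
          (\<lambda>x. indicator (box p q) x * g x)"
        using pq by (auto simp: indicator_def fun_eq_iff)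
      moreover have "(LINT x|lebesgue. indicator (box p q) x * g x) = 0"
        using pq2 zero(1)[of p q] ab by (cases "box p q = {}") auto
      ultimately show "(LINT x|lebesgue. indicator (box c d) x * (indicator (box a b) x * g x)) = 0"
        by simp
    qed
    moreover have "AE x in lebesgue. x \<notin> cbox a b - box a b"
      by (rule AE_not_in) (metis negligible_frontier_interval negligible_iff_null_sets)
    ultimately show ?thesis by eventually_elim (auto simp: indicator_def split: if_splits)
  qed
  obtain D where D: "countable D" "D \<subseteq> Pow \<Omega>" "\<And>X. X \<in> D \<Longrightarrow> \<exists>a b. X = cbox a b" "\<Union>D = \<Omega>"
    using open_countable_Union_open_cbox[OF assms(1)] by metis
  have "AE x in lebesgue. \<forall>X\<in>D. x \<in> X \<longrightarrow> g x = 0"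
    unfolding AE_ball_countable[OF D(1)]
  proof
    fix X assume X: "X \<in> D"
    then obtain a b where "X = cbox a b" "cbox a b \<subseteq> \<Omega>" using D(2,3) by blast
    then show "AE x in lebesgue. x \<in> X \<longrightarrow> g x = 0" using on_box by simp
  qed
  then have "AE x in lebesgue. x \<in> \<Omega> \<longrightarrow> g x = 0"
    by eventually_elim (use D(4) in blast)
  then show ?thesis using \<Omega> by (simp add: AE_restrict_space_iff)
qed

lemma test_functionsE:
  assumes "\<phi> \<in> test_functions \<Omega>"
  obtains K where "\<And>k. C_k k \<phi>" "compact K" "K \<subseteq> \<Omega>" "\<And>x. x \<notin> K \<Longrightarrow> \<phi> x = 0"
proof -
  have "\<phi> x = 0" if "x \<notin> closure {x. \<phi> x \<noteq> 0}" for x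
    using that closure_subset[of "{x. \<phi> x \<noteq> 0}"] by blast
  then show thesis
    using assms that[of "closure {x. \<phi> x \<noteq> 0}"] unfolding test_functions_def by blast
qed

lemma test_function_L2:
  assumes "\<phi> \<in> test_functions \<Omega>" "S \<in> sets lebesgue"
  shows "\<phi> \<in> L2 S"
proof -
  obtain K where K: "\<And>k. C_k k \<phi>" "compact K" "\<And>x. x \<notin> K \<Longrightarrow> \<phi> x = 0"
    using test_functionsE[OF assms(1)] by metis
  have "continuous_on UNIV \<phi>" using K(1)[of 0] by simp
  then show ?thesis by (rule L2_continuous_compact_support[OF _ K(2,3) assms(2)])
qed

text \<open>This is what makes \<^const>\<open>weak_gradient\<close>, a choice among all weak gradients, a linear operation up to
  null sets.\<close>

lemma weak_gradient_unique:
  assumes "open \<Omega>" "is_weak_gradient \<Omega> v g" "is_weak_gradient \<Omega> v h"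
  shows "AE x in lebesgue_on \<Omega>. g x = h x"
proof -
  have "AE x in lebesgue_on \<Omega>. g x $ j - h x $ j = 0" for j
  proof (rule fundamental_lemma_calculus_of_variations[OF assms(1)])
    have gh: "(\<lambda>x. g x $ j) \<in> L2 \<Omega>" "(\<lambda>x. h x $ j) \<in> L2 \<Omega>"
      using assms by (auto simp: is_weak_gradient_def)
    then show "(\<lambda>x. g x $ j - h x $ j) \<in> L2 \<Omega>" by (rule L2_diff)
    fix \<phi> :: "real ^ 'a \<Rightarrow> real" assume \<phi>: "\<phi> \<in> test_functions \<Omega>"
    then have "\<phi> \<in> L2 \<Omega>"
      using assms(1) by (intro test_function_L2) auto
    then show "(LINT x|lebesgue_on \<Omega>. (g x $ j - h x $ j) * \<phi> x) = 0"
      using assms(2,3) \<phi> gh by (simp add: left_diff_distrib L2_mult_integrable is_weak_gradient_def)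
  qed
  then have "AE x in lebesgue_on \<Omega>. \<forall>j. g x $ j - h x $ j = 0"
    by (simp add: AE_all_countable)
  then show ?thesis by (simp add: vec_eq_iff)
qed

section \<open>Test functions and integration by parts\<close>

lemma has_derivative_partial:
  assumes "\<phi> differentiable (at x)"
  shows "((\<lambda>t. \<phi> (x + t *\<^sub>R axis j 1)) has_real_derivative partial j \<phi> x) (at 0)"
proof -
  have d: "(\<phi> has_derivative frechet_derivative \<phi> (at x)) (at (x + 0 *\<^sub>R axis j 1))"
    using assms by (simp add: frechet_derivative_works[symmetric])
  have "((\<lambda>t. x + t *\<^sub>R axis j 1) has_derivative (\<lambda>t. t *\<^sub>R axis j 1)) (at 0)"
    by (auto intro!: derivative_eq_intros)
  from has_derivative_compose[OF this d]
  have "((\<lambda>t. \<phi> (x + t *\<^sub>R axis j 1)) has_derivative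
      (\<lambda>t. frechet_derivative \<phi> (at x) (t *\<^sub>R axis j 1))) (at 0)" .
  moreover have "frechet_derivative \<phi> (at x) (t *\<^sub>R axis j 1) = partial j \<phi> x * t" for t
    using linear_scale[OF linear_frechet_derivative[OF assms]] by (simp add: partial_def)
  ultimately show ?thesis by (simp add: has_field_derivative_def)
qed

lemma has_derivative_partial_line:
  assumes "\<And>x. \<phi> differentiable (at x)"
  shows "((\<lambda>t. \<phi> (x + t *\<^sub>R axis j 1)) has_real_derivative partial j \<phi> (x + s *\<^sub>R axis j 1)) (at s)"
proof -
  have "((\<lambda>t. \<phi> (x + s *\<^sub>R axis j 1 + t *\<^sub>R axis j 1)) has_real_derivative
      partial j \<phi> (x + s *\<^sub>R axis j 1)) (at (s - s))"
    using has_derivative_partial[OF assms] by simp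
  moreover have "((\<lambda>t. t - s) has_real_derivative 1) (at s)"
    by (auto intro!: derivative_eq_intros)
  ultimately have "((\<lambda>t. \<phi> (x + s *\<^sub>R axis j 1 + (t - s) *\<^sub>R axis j 1)) has_real_derivative
      partial j \<phi> (x + s *\<^sub>R axis j 1) * 1) (at s)"
    by (rule DERIV_chain2[where g="\<lambda>t. t - s"])
  then show ?thesis by (simp add: algebra_simps)
qed

lemma partial_eq_0_outside:
  assumes "closed K" "\<And>x. x \<notin> K \<Longrightarrow> \<phi> x = 0" "x \<notin> K"
  shows "partial j \<phi> x = 0"
proof -
  have "(\<phi> has_derivative (\<lambda>_. 0)) (at x)"
    by (rule has_derivative_transform_within_open[of "\<lambda>_. 0" _ _ _ "- K"]) (use assms in auto)
  then show ?thesis by (simp add: partial_eqI)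
qed

lemma partial_add:
  assumes "\<phi> differentiable (at x)" "\<psi> differentiable (at x)"
  shows "partial j (\<lambda>x. \<phi> x + \<psi> x) x = partial j \<phi> x + partial j \<psi> x"
  using partial_eqI[OF has_derivative_add[OF assms[unfolded frechet_derivative_works]]]
  by (simp add: partial_def)

lemma partial_cmult:
  assumes "\<phi> differentiable (at x)"
  shows "partial j (\<lambda>x. c * \<phi> x) x = c * partial j \<phi> x"
  using partial_eqI[OF has_derivative_mult_right[OF assms[unfolded frechet_derivative_works]]]
  by (simp add: partial_def)

lemma partial_mult:
  assumes "\<phi> differentiable (at x)" "\<psi> differentiable (at x)"
  shows "partial j (\<lambda>x. \<phi> x * \<psi> x) x = \<phi> x * partial j \<psi> x + partial j \<phi> x * \<psi> x"
  using partial_eqI[OF has_derivative_mult[OF assms[unfolded frechet_derivative_works]]]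
  by (simp add: partial_def)

lemma C_k_add: "C_k k \<phi> \<Longrightarrow> C_k k \<psi> \<Longrightarrow> C_k k (\<lambda>x. \<phi> x + \<psi> x)"
proof (induction k arbitrary: \<phi> \<psi>)
  case 0
  then show ?case by (auto intro: continuous_intros)
next
  case (Suc k)
  then have "partial j (\<lambda>x. \<phi> x + \<psi> x) = (\<lambda>x. partial j \<phi> x + partial j \<psi> x)" for j
    by (intro ext partial_add) auto
  with Suc show ?case by auto
qed

lemma C_k_cmult: "C_k k \<phi> \<Longrightarrow> C_k k (\<lambda>x. c * \<phi> x)"
proof (induction k arbitrary: \<phi>)
  case 0
  then show ?case by (auto intro: continuous_intros)
next
  case (Suc k)
  then have "partial j (\<lambda>x. c * \<phi> x) = (\<lambda>x. c * partial j \<phi> x)" for j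
    by (intro ext partial_cmult) auto
  with Suc show ?case by auto
qed

lemma test_functionsI:
  assumes "\<And>k. C_k k \<phi>" "compact K" "K \<subseteq> \<Omega>" "\<And>x. x \<notin> K \<Longrightarrow> \<phi> x = 0"
  shows "\<phi> \<in> test_functions \<Omega>"
proof -
  have "closure {x. \<phi> x \<noteq> 0} \<subseteq> K"
    using assms by (intro closure_minimal) (auto simp: compact_imp_closed)
  moreover from this have "compact (closure {x. \<phi> x \<noteq> 0})"
    using assms(2) by (metis closed_closure compact_Int_closed inf.absorb_iff2)
  ultimately show ?thesis using assms by (auto simp: test_functions_def)
qed

lemma test_function_smooth:
  assumes "\<phi> \<in> test_functions \<Omega>"
  shows "C_k k \<phi>" "continuous_on UNIV \<phi>" "\<phi> differentiable (at x)"
    "continuous_on UNIV (partial j \<phi>)"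
proof -
  show C: "C_k k \<phi>" for k using assms by (auto simp: test_functions_def)
  show "continuous_on UNIV \<phi>" using C[of 0] by simp
  show "\<phi> differentiable (at x)" "continuous_on UNIV (partial j \<phi>)" using C[of 1] by auto
qed

lemma test_function_eq_0: "\<phi> \<in> test_functions \<Omega> \<Longrightarrow> x \<notin> \<Omega> \<Longrightarrow> \<phi> x = 0"
  by (erule test_functionsE) auto

lemma test_functions_mono: "\<omega> \<subseteq> \<Omega> \<Longrightarrow> test_functions \<omega> \<subseteq> test_functions \<Omega>"
  by (auto simp: test_functions_def)

lemma test_functions_partial:
  assumes "\<phi> \<in> test_functions \<Omega>"
  shows "partial j \<phi> \<in> test_functions \<Omega>"
proof -
  obtain K where K: "compact K" "K \<subseteq> \<Omega>" "\<And>x. x \<notin> K \<Longrightarrow> \<phi> x = 0"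
    using test_functionsE[OF assms] by metis
  show ?thesis
  proof (rule test_functionsI[OF _ K(1,2)])
    show "C_k k (partial j \<phi>)" for k using test_function_smooth(1)[OF assms, of "Suc k"] by simp
    show "partial j \<phi> x = 0" if "x \<notin> K" for x
      using partial_eq_0_outside[OF compact_imp_closed[OF K(1)] K(3) that] .
  qed
qed

lemma subspace_test_functions: "subspace (test_functions \<Omega>)"
proof (rule subspaceI)
  have "C_k k (\<lambda>x :: real ^ 'a. 0)" for k
    using C_k_cmult[OF C_k_box_bump, of k 0] by simp
  then show "0 \<in> test_functions \<Omega>"
    by (intro test_functionsI[of _ "{}"]) (auto simp: zero_fun_def)
  fix \<phi> :: "real ^ 'a \<Rightarrow> real" and c :: real
  assume \<phi>: "\<phi> \<in> test_functions \<Omega>"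
  obtain K where K: "compact K" "K \<subseteq> \<Omega>" "\<And>x. x \<notin> K \<Longrightarrow> \<phi> x = 0"
    using test_functionsE[OF \<phi>] by metis
  show "c *\<^sub>R \<phi> \<in> test_functions \<Omega>"
    by (rule test_functionsI[OF _ K(1,2)])
      (use K test_function_smooth(1)[OF \<phi>] in \<open>auto simp: scaleR_fun_def C_k_cmult\<close>)
  fix \<psi> :: "real ^ 'a \<Rightarrow> real"
  assume \<psi>: "\<psi> \<in> test_functions \<Omega>"
  obtain L where L: "compact L" "L \<subseteq> \<Omega>" "\<And>x. x \<notin> L \<Longrightarrow> \<psi> x = 0"
    using test_functionsE[OF \<psi>] by metis
  show "\<phi> + \<psi> \<in> test_functions \<Omega>"
    by (rule test_functionsI[OF _ compact_Un[OF K(1) L(1)]])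
      (use K L test_function_smooth(1)[OF \<phi>] test_function_smooth(1)[OF \<psi>]
        in \<open>auto simp: plus_fun_def C_k_add\<close>)
qed

text \<open>By translation invariance the difference quotients of \<open>F\<close> in direction \<open>j\<close> have integral zero. They
  converge to the partial derivative, and by the mean value theorem they are bounded by its supremum
  and supported in a fixed ball, so dominated convergence applies.\<close>

lemma integral_partial_eq_0:
  fixes F :: "real ^ 'n \<Rightarrow> real"
  assumes diff: "\<And>x. F differentiable (at x)" and cont: "continuous_on UNIV (partial j F)"
    and K: "compact K" "\<And>x. x \<notin> K \<Longrightarrow> F x = 0"
  shows "(LINT x|lebesgue. partial j F x) = 0"
proof -
  define e :: "real ^ 'n" where "e = axis j 1"
  have ne: "norm e = 1" by (simp add: e_def norm_axis_1)
  \<comment> \<open>Step sizes at most \<open>1\<close>, so that enlarging the radius by \<open>1\<close> covers the supports of all quotients.\<close>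
  define h :: "nat \<Rightarrow> real" where "h m = inverse (real (Suc m))" for m
  have h: "h m > 0" "h m \<le> 1" for m
    by (auto simp: h_def divide_simps)
  define D where "D m x = (F (x + h m *\<^sub>R e) - F x) / h m" for m x
  have contF: "continuous_on UNIV F"
    using diff by (meson continuous_at_imp_continuous_on differentiable_imp_continuous_within)
  have [measurable]: "F \<in> borel_measurable borel" "partial j F \<in> borel_measurable borel"
    using contF cont by (auto intro: borel_measurable_continuous_onI)
  obtain R where R: "\<And>x. x \<in> K \<Longrightarrow> norm x \<le> R"
    using K(1) compact_imp_bounded bounded_iff by metis
  define L where "L = cball (0 :: real ^ 'n) (R + 1)"
  have "bounded (partial j F ` L)"
    unfolding L_def
    by (intro compact_imp_bounded compact_continuous_image continuous_on_subset[OF cont]) auto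
  then obtain B where B: "\<And>x. x \<in> L \<Longrightarrow> \<bar>partial j F x\<bar> \<le> B" unfolding bounded_iff by auto
  have "\<bar>partial j F x\<bar> \<le> max B 0" for x
  proof (cases "x \<in> L")
    case False
    then have "x \<notin> K" using R[of x] by (auto simp: L_def)
    then show ?thesis using partial_eq_0_outside[OF compact_imp_closed[OF K(1)] K(2)] by simp
  qed (use B in force)
  then obtain B where B: "\<And>x. \<bar>partial j F x\<bar> \<le> B" by blast
  have D_bound: "\<bar>D m x\<bar> \<le> B * indicator L x" for m x
  proof (cases "x \<in> L")
    case True
    obtain s where "F (x + h m *\<^sub>R e) - F (x + 0 *\<^sub>R e) = (h m - 0) * partial j F (x + s *\<^sub>R e)"
      using MVT2[of 0 "h m" "\<lambda>t. F (x + t *\<^sub>R e)" "\<lambda>t. partial j F (x + t *\<^sub>R e)"]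
        has_derivative_partial_line[OF diff] h(1) unfolding e_def by metis
    then have "D m x = partial j F (x + s *\<^sub>R e)" using h(1)[of m] by (simp add: D_def)
    then show ?thesis using B True by simp
  next
    case False
    have "norm x \<le> norm (x + h m *\<^sub>R e) + norm (h m *\<^sub>R e)"
      by (metis add_diff_cancel norm_triangle_ineq4)
    then have "norm (x + h m *\<^sub>R e) > R" "norm x > R"
      using False h[of m] ne by (auto simp: L_def)
    then have "x \<notin> K" "x + h m *\<^sub>R e \<notin> K" using R by force+
    then show ?thesis using False K(2) by (simp add: D_def)
  qed
  have D_lim: "(\<lambda>m. D m x) \<longlonglongrightarrow> partial j F x" for x
  proof -
    have "((\<lambda>t. (F (x + t *\<^sub>R e) - F x) / t) \<longlongrightarrow> partial j F x) (at 0)"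
      using has_derivative_partial[OF diff, of x j] by (simp add: DERIV_def e_def)
    moreover have "filterlim h (at 0) sequentially"
      unfolding h_def filterlim_at using LIMSEQ_inverse_real_of_nat by auto
    ultimately show ?thesis unfolding D_def by (rule filterlim_compose)
  qed
  have "L \<in> sets lborel" "emeasure lborel L < \<infinity>"
    using emeasure_bounded_finite[of L] by (auto simp: L_def)
  then have dom: "integrable lborel (\<lambda>x. B * indicator L x)" by simp
  have "(\<lambda>m. \<integral>x. D m x \<partial>lborel) \<longlonglongrightarrow> (\<integral>x. partial j F x \<partial>lborel)"
  proof (rule integral_dominated_convergence[OF _ _ dom])
    show "partial j F \<in> borel_measurable lborel" by simp
    show "D m \<in> borel_measurable lborel" for m unfolding D_def by measurable
  qed (use D_bound D_lim in auto)
  moreover have "(\<integral>x. D m x \<partial>lborel) = 0" for m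
  proof -
    have F: "integrable lborel F"
    proof -
      have "set_integrable lborel K F"
        unfolding set_integrable_def using borel_integrable_compact[OF K(1) continuous_on_subset[OF contF]]
        by (simp add: indicator_def if_distrib cong: if_cong)
      moreover have "(\<lambda>x. indicator K x *\<^sub>R F x) = F" using K(2) by (auto simp: indicator_def fun_eq_iff)
      ultimately show ?thesis by (simp add: set_integrable_def)
    qed
    have "integrable (distr lborel borel ((+) (h m *\<^sub>R e))) F" using F by (simp add: lborel_distr_plus)
    then have "integrable lborel (\<lambda>x. F (x + h m *\<^sub>R e))"
      by (subst (asm) integrable_distr_eq) (auto simp: add.commute)
    moreover have "(\<integral>x. F x \<partial>lborel) = (\<integral>x. F x \<partial>distr lborel borel ((+) (h m *\<^sub>R e)))"
      by (simp add: lborel_distr_plus)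
    then have "(\<integral>x. F x \<partial>lborel) = (\<integral>x. F (x + h m *\<^sub>R e) \<partial>lborel)"
      using integral_distr[of "(+) (h m *\<^sub>R e)" lborel borel F] by (simp add: add.commute)
    ultimately show ?thesis using F by (simp add: D_def)
  qed
  ultimately have "(\<integral>x. partial j F x \<partial>lborel) = 0" by (simp add: LIMSEQ_const_iff)
  then show ?thesis by (subst integral_completion) auto
qed

text \<open>Only \<open>\<phi>\<close> has to vanish near the boundary of \<open>\<omega>\<close>. The second function may be a test function on a
  larger domain, which is the case needed for extension by zero.\<close>

lemma test_function_integration_by_parts:
  fixes \<phi> \<psi> :: "real ^ 'n \<Rightarrow> real"
  assumes \<omega>: "\<omega> \<in> sets lebesgue" and \<phi>: "\<phi> \<in> test_functions \<omega>" and \<psi>: "\<psi> \<in> test_functions \<Omega>"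
  shows "(LINT x|lebesgue_on \<omega>. \<phi> x * partial j \<psi> x) = - (LINT x|lebesgue_on \<omega>. partial j \<phi> x * \<psi> x)"
proof -
  obtain K where K: "compact K" "\<And>x. x \<notin> K \<Longrightarrow> \<phi> x = 0" using test_functionsE[OF \<phi>] by metis
  note s\<phi> = test_function_smooth[OF \<phi>] and s\<psi> = test_function_smooth[OF \<psi>]
  note p\<phi> = test_functions_partial[OF \<phi>] and p\<psi> = test_functions_partial[OF \<psi>]
  have eq: "partial j (\<lambda>x. \<phi> x * \<psi> x) = (\<lambda>x. \<phi> x * partial j \<psi> x + partial j \<phi> x * \<psi> x)"
    by (intro ext partial_mult s\<phi> s\<psi>)
  have "(LINT x|lebesgue. partial j (\<lambda>x. \<phi> x * \<psi> x) x) = 0"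
  proof (rule integral_partial_eq_0[OF _ _ K(1)])
    show "(\<lambda>x. \<phi> x * \<psi> x) differentiable at x" for x by (intro differentiable_mult s\<phi> s\<psi>)
    show "continuous_on UNIV (partial j (\<lambda>x. \<phi> x * \<psi> x))"
      unfolding eq by (intro continuous_intros s\<phi> s\<psi>)
  qed (use K in auto)
  moreover have "(\<lambda>x. indicator \<omega> x *\<^sub>R partial j (\<lambda>x. \<phi> x * \<psi> x) x) = partial j (\<lambda>x. \<phi> x * \<psi> x)"
    unfolding eq using test_function_eq_0[OF \<phi>] test_function_eq_0[OF p\<phi>]
    by (auto simp: indicator_def fun_eq_iff)
  ultimately have "(LINT x|lebesgue_on \<omega>. partial j (\<lambda>x. \<phi> x * \<psi> x) x) = 0"
    using \<omega> by (simp add: integral_restrict_space)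
  moreover have "integrable (lebesgue_on \<omega>) (\<lambda>x. \<phi> x * partial j \<psi> x)"
    "integrable (lebesgue_on \<omega>) (\<lambda>x. partial j \<phi> x * \<psi> x)"
    using \<phi> \<psi> p\<phi> p\<psi> by (auto intro!: L2_mult_integrable test_function_L2[OF _ \<omega>])
  ultimately show ?thesis unfolding eq by simp
qed

definition classical_gradient :: "(real ^ 'n \<Rightarrow> real) \<Rightarrow> real ^ 'n \<Rightarrow> real ^ 'n"
  where "classical_gradient \<phi> x = (\<chi> j. partial j \<phi> x)"

lemma is_weak_gradient_test_function:
  assumes "open \<omega>" "\<phi> \<in> test_functions \<omega>"
  shows "is_weak_gradient \<omega> \<phi> (classical_gradient \<phi>)"
  using assms test_function_integration_by_parts[OF _ assms(2)]
  by (auto simp: is_weak_gradient_def classical_gradient_def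
      intro!: test_function_L2[OF test_functions_partial[OF assms(2)]])

section \<open>The spaces H1 and H10\<close>

lemma is_weak_gradient_weak_gradient:
  "is_weak_gradient \<Omega> v g \<Longrightarrow> is_weak_gradient \<Omega> v (weak_gradient \<Omega> v)"
  unfolding weak_gradient_def by (rule someI[of "is_weak_gradient \<Omega> v"])

lemma weak_gradient_ae_eq:
  assumes "open \<Omega>" "is_weak_gradient \<Omega> v g"
  shows "AE x in lebesgue_on \<Omega>. weak_gradient \<Omega> v x = g x"
  by (rule weak_gradient_unique[OF assms(1) is_weak_gradient_weak_gradient[OF assms(2)] assms(2)])

lemma H1_D:
  assumes "v \<in> H1 \<Omega>"
  shows "v \<in> L2 \<Omega>" "is_weak_gradient \<Omega> v (weak_gradient \<Omega> v)"
  using assms by (auto simp: H1_def intro: is_weak_gradient_weak_gradient)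

lemma is_weak_gradient_L2: "is_weak_gradient \<Omega> v g \<Longrightarrow> (\<lambda>x. g x $ j) \<in> L2 \<Omega>"
  by (simp add: is_weak_gradient_def)

lemma is_weak_gradient_add:
  assumes \<Omega>: "open \<Omega>" and v: "v \<in> L2 \<Omega>" "is_weak_gradient \<Omega> v g"
    and w: "w \<in> L2 \<Omega>" "is_weak_gradient \<Omega> w h"
  shows "is_weak_gradient \<Omega> (v + w) (\<lambda>x. g x + h x)"
  unfolding is_weak_gradient_def
proof (intro allI conjI ballI)
  fix j
  have gh: "(\<lambda>x. g x $ j) \<in> L2 \<Omega>" "(\<lambda>x. h x $ j) \<in> L2 \<Omega>"
    using v w is_weak_gradient_L2 by auto
  then show "(\<lambda>x. (g x + h x) $ j) \<in> L2 \<Omega>" by (simp add: L2_add)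
  fix \<phi> assume \<phi>: "\<phi> \<in> test_functions \<Omega>"
  have t: "\<phi> \<in> L2 \<Omega>" "partial j \<phi> \<in> L2 \<Omega>"
    using \<Omega> test_function_L2[OF \<phi>] test_function_L2[OF test_functions_partial[OF \<phi>]] by auto
  have "(LINT x|lebesgue_on \<Omega>. (v + w) x * partial j \<phi> x) =
      (LINT x|lebesgue_on \<Omega>. v x * partial j \<phi> x) + (LINT x|lebesgue_on \<Omega>. w x * partial j \<phi> x)"
    by (simp add: distrib_right L2_mult_integrable v w t)
  also have "\<dots> = - (LINT x|lebesgue_on \<Omega>. g x $ j * \<phi> x) - (LINT x|lebesgue_on \<Omega>. h x $ j * \<phi> x)"
    using v w \<phi> by (simp add: is_weak_gradient_def)
  also have "\<dots> = - (LINT x|lebesgue_on \<Omega>. (g x + h x) $ j * \<phi> x)"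
    by (simp add: distrib_right L2_mult_integrable gh t)
  finally show "(LINT x|lebesgue_on \<Omega>. (v + w) x * partial j \<phi> x) =
      - (LINT x|lebesgue_on \<Omega>. (g x + h x) $ j * \<phi> x)" .
qed

lemma is_weak_gradient_scaleR:
  assumes "is_weak_gradient \<Omega> v g"
  shows "is_weak_gradient \<Omega> (c *\<^sub>R v) (\<lambda>x. c *\<^sub>R g x)"
  using assms by (simp add: is_weak_gradient_def scaleR_fun_def L2_scale mult.assoc)

lemma subspace_H1:
  assumes "open \<Omega>"
  shows "subspace (H1 \<Omega>)"
proof (rule subspaceI)
  have "is_weak_gradient \<Omega> 0 (\<lambda>_. 0)"
    using subspace_0[OF subspace_L2, of \<Omega>] by (simp add: is_weak_gradient_def zero_fun_def)
  then show "0 \<in> H1 \<Omega>" using subspace_0[OF subspace_L2] by (auto simp: H1_def)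
  show "v + w \<in> H1 \<Omega>" if "v \<in> H1 \<Omega>" "w \<in> H1 \<Omega>" for v w
    using is_weak_gradient_add[OF assms H1_D[OF that(1)] H1_D[OF that(2)]]
      subspace_add[OF subspace_L2 H1_D(1)[OF that(1)] H1_D(1)[OF that(2)]]
    by (auto simp: H1_def)
  show "c *\<^sub>R v \<in> H1 \<Omega>" if "v \<in> H1 \<Omega>" for c v
    using is_weak_gradient_scaleR[OF H1_D(2)[OF that]] subspace_scale[OF subspace_L2 H1_D(1)[OF that]]
    by (auto simp: H1_def)
qed

lemma weak_gradient_add:
  assumes "open \<Omega>" "v \<in> H1 \<Omega>" "w \<in> H1 \<Omega>"
  shows "AE x in lebesgue_on \<Omega>. weak_gradient \<Omega> (v + w) x = weak_gradient \<Omega> v x + weak_gradient \<Omega> w x"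
  using weak_gradient_ae_eq[OF assms(1) is_weak_gradient_add] H1_D assms by blast

lemma weak_gradient_scaleR:
  assumes "open \<Omega>" "v \<in> H1 \<Omega>"
  shows "AE x in lebesgue_on \<Omega>. weak_gradient \<Omega> (c *\<^sub>R v) x = c *\<^sub>R weak_gradient \<Omega> v x"
  using weak_gradient_ae_eq[OF assms(1) is_weak_gradient_scaleR[OF H1_D(2)[OF assms(2)]]] .

lemma L2_vec_measurable:
  fixes g :: "real ^ 'n \<Rightarrow> real ^ 'm"
  assumes "\<And>j. (\<lambda>x. g x $ j) \<in> L2 \<Omega>"
  shows "g \<in> borel_measurable (lebesgue_on \<Omega>)"
  unfolding borel_measurable_euclidean_space[of g]
  using L2_D(1)[OF assms] by (auto simp: Basis_vec_def inner_axis)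

lemma L2_inner_integrable:
  fixes g h :: "real ^ 'n \<Rightarrow> real ^ 'm"
  assumes "\<And>j. (\<lambda>x. g x $ j) \<in> L2 \<Omega>" "\<And>j. (\<lambda>x. h x $ j) \<in> L2 \<Omega>"
  shows "integrable (lebesgue_on \<Omega>) (\<lambda>x. g x \<bullet> h x)"
  unfolding inner_vec_def inner_real_def
  using assms by (intro Bochner_Integration.integrable_sum L2_mult_integrable)

lemma L2_norm_integrable:
  fixes g :: "real ^ 'n \<Rightarrow> real ^ 'm"
  assumes "\<And>j. (\<lambda>x. g x $ j) \<in> L2 \<Omega>"
  shows "integrable (lebesgue_on \<Omega>) (\<lambda>x. (norm (g x))\<^sup>2)"
  using L2_inner_integrable[OF assms assms] by (simp add: power2_norm_eq_inner)

lemma is_weak_gradient_measurable: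
  assumes "is_weak_gradient \<Omega> v g"
  shows "g \<in> borel_measurable (lebesgue_on \<Omega>)"
  using is_weak_gradient_L2[OF assms] by (rule L2_vec_measurable)

lemma H1_norm_eq:
  assumes "open \<Omega>" "is_weak_gradient \<Omega> v g"
  shows "H1_norm \<Omega> v =
    sqrt ((LINT x|lebesgue_on \<Omega>. (v x)\<^sup>2) + (LINT x|lebesgue_on \<Omega>. (norm (g x))\<^sup>2))"
proof -
  have "is_weak_gradient \<Omega> v (weak_gradient \<Omega> v)"
    using assms(2) by (rule is_weak_gradient_weak_gradient)
  then have "weak_gradient \<Omega> v \<in> borel_measurable (lebesgue_on \<Omega>)"
    "g \<in> borel_measurable (lebesgue_on \<Omega>)"
    using assms(2) is_weak_gradient_measurable by blast+
  then have "(LINT x|lebesgue_on \<Omega>. (norm (weak_gradient \<Omega> v x))\<^sup>2) = (LINT x|lebesgue_on \<Omega>. (norm (g x))\<^sup>2)"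
    using weak_gradient_ae_eq[OF assms] by (intro integral_cong_AE) (auto elim: eventually_mono)
  then show ?thesis by (simp add: H1_norm_def)
qed

lemma H1_norm_nonneg: "0 \<le> H1_norm \<Omega> v"
  by (simp add: H1_norm_def)

lemma L2_norms_le_H1_norm:
  assumes "open \<Omega>" "is_weak_gradient \<Omega> v g"
  shows "sqrt (LINT x|lebesgue_on \<Omega>. (v x)\<^sup>2) \<le> H1_norm \<Omega> v"
    and "sqrt (LINT x|lebesgue_on \<Omega>. (g x $ j)\<^sup>2) \<le> H1_norm \<Omega> v"
proof -
  show "sqrt (LINT x|lebesgue_on \<Omega>. (v x)\<^sup>2) \<le> H1_norm \<Omega> v"
    by (simp add: H1_norm_def)
  have g: "\<And>j. (\<lambda>x. g x $ j) \<in> L2 \<Omega>" using is_weak_gradient_L2[OF assms(2)] .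
  have "(LINT x|lebesgue_on \<Omega>. (g x $ j)\<^sup>2) \<le> (LINT x|lebesgue_on \<Omega>. (norm (g x))\<^sup>2)"
    by (intro integral_mono L2_D(2)[OF g] L2_norm_integrable g)
      (simp add: abs_le_square_iff[symmetric] component_le_norm_cart)
  then show "sqrt (LINT x|lebesgue_on \<Omega>. (g x $ j)\<^sup>2) \<le> H1_norm \<Omega> v"
    unfolding H1_norm_eq[OF assms] by (intro real_sqrt_le_mono) (simp add: add_increasing)
qed

lemma H1_norm_scaleR:
  assumes "open \<Omega>" "v \<in> H1 \<Omega>"
  shows "H1_norm \<Omega> (c *\<^sub>R v) = \<bar>c\<bar> * H1_norm \<Omega> v"
proof -
  have "H1_norm \<Omega> (c *\<^sub>R v) = sqrt (c\<^sup>2 * ((LINT x|lebesgue_on \<Omega>. (v x)\<^sup>2)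
      + (LINT x|lebesgue_on \<Omega>. (norm (weak_gradient \<Omega> v x))\<^sup>2)))"
    unfolding H1_norm_eq[OF assms(1) is_weak_gradient_scaleR[OF H1_D(2)[OF assms(2)]]]
    by (simp add: scaleR_fun_def power_mult_distrib distrib_left)
  then show ?thesis by (simp add: real_sqrt_mult H1_norm_def)
qed

text \<open>A weak form of the triangle inequality, sufficient to see that limits in \<^const>\<open>H1_norm\<close> are additive.\<close>

lemma H1_norm_add_le:
  assumes \<Omega>: "open \<Omega>" and v: "v \<in> H1 \<Omega>" and w: "w \<in> H1 \<Omega>"
  shows "(H1_norm \<Omega> (v + w))\<^sup>2 \<le> 2 * (H1_norm \<Omega> v)\<^sup>2 + 2 * (H1_norm \<Omega> w)\<^sup>2"
proof -
  let ?g = "weak_gradient \<Omega> v" and ?h = "weak_gradient \<Omega> w"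
  have g: "\<And>j. (\<lambda>x. ?g x $ j) \<in> L2 \<Omega>" and h: "\<And>j. (\<lambda>x. ?h x $ j) \<in> L2 \<Omega>"
    using H1_D(2)[OF v] H1_D(2)[OF w] is_weak_gradient_L2 by auto
  have gh: "(\<lambda>x. (?g x + ?h x) $ j) \<in> L2 \<Omega>" for j using L2_add[OF g h] by simp
  have vw: "(\<lambda>x. v x + w x) \<in> L2 \<Omega>" using L2_add H1_D v w by blast
  note ints = L2_D(2)[OF H1_D(1)[OF v]] L2_D(2)[OF H1_D(1)[OF w]]
    L2_norm_integrable[OF g] L2_norm_integrable[OF h]
  have sq: "(r + s)\<^sup>2 \<le> 2 * r\<^sup>2 + 2 * s\<^sup>2" for r s :: real
    using sum_squares_bound[of r s] by (simp add: power2_sum)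
  have "(LINT x|lebesgue_on \<Omega>. (v x + w x)\<^sup>2) \<le>
      (LINT x|lebesgue_on \<Omega>. 2 * (v x)\<^sup>2 + 2 * (w x)\<^sup>2)"
    using ints by (intro integral_mono L2_D(2)[OF vw] sq) auto
  also have "\<dots> = 2 * (LINT x|lebesgue_on \<Omega>. (v x)\<^sup>2) + 2 * (LINT x|lebesgue_on \<Omega>. (w x)\<^sup>2)"
    using ints by simp
  finally have 1: "(LINT x|lebesgue_on \<Omega>. (v x + w x)\<^sup>2) \<le> \<dots>" .
  have "(norm (?g x + ?h x))\<^sup>2 \<le> 2 * (norm (?g x))\<^sup>2 + 2 * (norm (?h x))\<^sup>2" for x
    using power_mono[OF norm_triangle_ineq norm_ge_zero, of "?g x" "?h x" 2]
      sq[of "norm (?g x)" "norm (?h x)"] by linarith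
  then have "(LINT x|lebesgue_on \<Omega>. (norm (?g x + ?h x))\<^sup>2) \<le>
      (LINT x|lebesgue_on \<Omega>. 2 * (norm (?g x))\<^sup>2 + 2 * (norm (?h x))\<^sup>2)"
    using ints by (intro integral_mono L2_norm_integrable[OF gh]) auto
  also have "\<dots> = 2 * (LINT x|lebesgue_on \<Omega>. (norm (?g x))\<^sup>2) + 2 * (LINT x|lebesgue_on \<Omega>. (norm (?h x))\<^sup>2)"
    using ints by simp
  finally have 2: "(LINT x|lebesgue_on \<Omega>. (norm (?g x + ?h x))\<^sup>2) \<le> \<dots>" .
  have "(H1_norm \<Omega> (v + w))\<^sup>2 =
      (LINT x|lebesgue_on \<Omega>. (v x + w x)\<^sup>2) + (LINT x|lebesgue_on \<Omega>. (norm (?g x + ?h x))\<^sup>2)"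
    by (subst H1_norm_eq[OF \<Omega> is_weak_gradient_add[OF \<Omega> H1_D[OF v] H1_D[OF w]]]) simp
  with 1 2 show ?thesis by (simp add: H1_norm_def)
qed

lemma test_functions_subset_H1:
  assumes "open \<Omega>"
  shows "test_functions \<Omega> \<subseteq> H1 \<Omega>"
  using assms by (auto simp: H1_def intro: test_function_L2 is_weak_gradient_test_function)

lemma H10_I:
  assumes "v \<in> H1 \<Omega>" "\<And>m. \<phi> m \<in> test_functions \<Omega>" "(\<lambda>m. H1_norm \<Omega> (v - \<phi> m)) \<longlonglongrightarrow> 0"
  shows "v \<in> H10 \<Omega>"
  using assms by (auto simp: H10_def)

lemma H10_E:
  assumes "v \<in> H10 \<Omega>"
  obtains \<phi> where "v \<in> H1 \<Omega>" "\<And>m. \<phi> m \<in> test_functions \<Omega>" "(\<lambda>m. H1_norm \<Omega> (v - \<phi> m)) \<longlonglongrightarrow> 0"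
  using assms by (auto simp: H10_def)

lemma H10_subset_H1: "H10 \<Omega> \<subseteq> H1 \<Omega>"
  by (auto simp: H10_def)

lemma test_functions_subset_H10:
  assumes "open \<Omega>"
  shows "test_functions \<Omega> \<subseteq> H10 \<Omega>"
proof
  fix \<phi> assume \<phi>: "\<phi> \<in> test_functions \<Omega>"
  have "H1_norm \<Omega> (0 *\<^sub>R 0 :: real ^ 'a \<Rightarrow> real) = 0"
    using H1_norm_scaleR[OF assms subspace_0[OF subspace_H1[OF assms]], of 0] by simp
  then show "\<phi> \<in> H10 \<Omega>"
    using \<phi> test_functions_subset_H1[OF assms] by (intro H10_I[of \<phi> \<Omega> "\<lambda>_. \<phi>"]) auto
qed

lemma subspace_H10:
  assumes \<Omega>: "open \<Omega>"
  shows "subspace (H10 \<Omega>)"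
proof (rule subspaceI)
  show "0 \<in> H10 \<Omega>"
    using test_functions_subset_H10[OF \<Omega>] subspace_0[OF subspace_test_functions] by blast
next
  fix v w assume v: "v \<in> H10 \<Omega>" and w: "w \<in> H10 \<Omega>"
  obtain \<phi> where \<phi>: "v \<in> H1 \<Omega>" "\<And>m. \<phi> m \<in> test_functions \<Omega>" "(\<lambda>m. H1_norm \<Omega> (v - \<phi> m)) \<longlonglongrightarrow> 0"
    using H10_E[OF v] by metis
  obtain \<psi> where \<psi>: "w \<in> H1 \<Omega>" "\<And>m. \<psi> m \<in> test_functions \<Omega>" "(\<lambda>m. H1_norm \<Omega> (w - \<psi> m)) \<longlonglongrightarrow> 0"
    using H10_E[OF w] by metis
  show "v + w \<in> H10 \<Omega>"
  proof (rule H10_I)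
    show "v + w \<in> H1 \<Omega>" using subspace_add[OF subspace_H1[OF \<Omega>]] \<phi> \<psi> by blast
    show "\<phi> m + \<psi> m \<in> test_functions \<Omega>" for m using subspace_add[OF subspace_test_functions] \<phi> \<psi> by blast
    have "(H1_norm \<Omega> (v + w - (\<phi> m + \<psi> m)))\<^sup>2 \<le>
        2 * (H1_norm \<Omega> (v - \<phi> m))\<^sup>2 + 2 * (H1_norm \<Omega> (w - \<psi> m))\<^sup>2" for m
    proof -
      have "v - \<phi> m \<in> H1 \<Omega>" "w - \<psi> m \<in> H1 \<Omega>"
        using \<phi> \<psi> test_functions_subset_H1[OF \<Omega>] by (blast intro: subspace_diff[OF subspace_H1[OF \<Omega>]])+
      from H1_norm_add_le[OF \<Omega> this] show ?thesis by (simp add: algebra_simps)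
    qed
    then have bound: "\<forall>\<^sub>F m in sequentially. norm ((H1_norm \<Omega> (v + w - (\<phi> m + \<psi> m)))\<^sup>2) \<le>
        2 * (H1_norm \<Omega> (v - \<phi> m))\<^sup>2 + 2 * (H1_norm \<Omega> (w - \<psi> m))\<^sup>2"
      by simp
    have "(\<lambda>m. 2 * (H1_norm \<Omega> (v - \<phi> m))\<^sup>2 + 2 * (H1_norm \<Omega> (w - \<psi> m))\<^sup>2) \<longlonglongrightarrow> 2 * 0\<^sup>2 + 2 * 0\<^sup>2"
      by (intro tendsto_intros \<phi>(3) \<psi>(3))
    then have "(\<lambda>m. (H1_norm \<Omega> (v + w - (\<phi> m + \<psi> m)))\<^sup>2) \<longlonglongrightarrow> 0"
      using Lim_null_comparison[OF bound] by simp
    from tendsto_real_sqrt[OF this]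
    show "(\<lambda>m. H1_norm \<Omega> (v + w - (\<phi> m + \<psi> m))) \<longlonglongrightarrow> 0" by (simp add: H1_norm_nonneg)
  qed
next
  fix v and c :: real assume v: "v \<in> H10 \<Omega>"
  obtain \<phi> where \<phi>: "v \<in> H1 \<Omega>" "\<And>m. \<phi> m \<in> test_functions \<Omega>" "(\<lambda>m. H1_norm \<Omega> (v - \<phi> m)) \<longlonglongrightarrow> 0"
    using H10_E[OF v] by metis
  show "c *\<^sub>R v \<in> H10 \<Omega>"
  proof (rule H10_I)
    show "c *\<^sub>R v \<in> H1 \<Omega>" using subspace_scale[OF subspace_H1[OF \<Omega>]] \<phi> by blast
    show "c *\<^sub>R \<phi> m \<in> test_functions \<Omega>" for m using subspace_scale[OF subspace_test_functions] \<phi> by blast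
    have "H1_norm \<Omega> (c *\<^sub>R v - c *\<^sub>R \<phi> m) = \<bar>c\<bar> * H1_norm \<Omega> (v - \<phi> m)" for m
    proof -
      have "v - \<phi> m \<in> H1 \<Omega>"
        using \<phi> test_functions_subset_H1[OF \<Omega>] by (blast intro: subspace_diff[OF subspace_H1[OF \<Omega>]])
      from H1_norm_scaleR[OF \<Omega> this] show ?thesis by (simp add: scaleR_right_diff_distrib)
    qed
    then show "(\<lambda>m. H1_norm \<Omega> (c *\<^sub>R v - c *\<^sub>R \<phi> m)) \<longlonglongrightarrow> 0"
      using tendsto_mult_left[OF \<phi>(3), of "\<bar>c\<bar>"] by simp
  qed
qed

section \<open>Extension by zero\<close>

text \<open>Elements of \<^const>\<open>H10\<close> may be tested with functions that do not vanish on the boundary of \<open>\<omega>\<close>: the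
  identity is known for the approximating test functions, and by Cauchy-Schwarz its defect \<open>E\<close> at \<open>v\<close>
  is at most a constant times the distance of \<open>v\<close> to them in \<^const>\<open>H1_norm\<close>.\<close>

lemma H10_integration_by_parts:
  assumes \<omega>: "open \<omega>" and v: "v \<in> H10 \<omega>" and \<psi>: "\<psi> \<in> test_functions \<Omega>"
  shows "(LINT x|lebesgue_on \<omega>. v x * partial j \<psi> x) =
    - (LINT x|lebesgue_on \<omega>. weak_gradient \<omega> v x $ j * \<psi> x)"
proof -
  obtain \<phi> where \<phi>: "v \<in> H1 \<omega>" "\<And>m. \<phi> m \<in> test_functions \<omega>" "(\<lambda>m. H1_norm \<omega> (v - \<phi> m)) \<longlonglongrightarrow> 0"
    using H10_E[OF v] by metis
  let ?g = "weak_gradient \<omega> v"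
  have \<omega>m: "\<omega> \<in> sets lebesgue" using \<omega> by auto
  note vL = H1_D(1)[OF \<phi>(1)] and gL = is_weak_gradient_L2[OF H1_D(2)[OF \<phi>(1)], of j]
  have \<psi>L: "\<psi> \<in> L2 \<omega>" "partial j \<psi> \<in> L2 \<omega>"
    using \<psi> test_functions_partial[OF \<psi>] by (auto intro: test_function_L2 \<omega>m)
  define E where "E = (LINT x|lebesgue_on \<omega>. v x * partial j \<psi> x) + (LINT x|lebesgue_on \<omega>. ?g x $ j * \<psi> x)"
  define C where "C = sqrt (LINT x|lebesgue_on \<omega>. (partial j \<psi> x)\<^sup>2) + sqrt (LINT x|lebesgue_on \<omega>. (\<psi> x)\<^sup>2)"
  have bound: "\<bar>E\<bar> \<le> H1_norm \<omega> (v - \<phi> m) * C" for m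
  proof -
    define w where "w = v + (- 1) *\<^sub>R \<phi> m"
    define h where "h x = ?g x + (- 1) *\<^sub>R classical_gradient (\<phi> m) x" for x
    have \<phi>L: "\<phi> m \<in> L2 \<omega>" "partial j (\<phi> m) \<in> L2 \<omega>"
      using \<phi>(2)[of m] test_functions_partial[OF \<phi>(2)] by (auto intro: test_function_L2 \<omega>m)
    have wh: "is_weak_gradient \<omega> w h" unfolding w_def h_def
      by (intro is_weak_gradient_add is_weak_gradient_scaleR is_weak_gradient_test_function
          \<omega> vL H1_D \<phi> subspace_scale[OF subspace_L2] \<phi>L)
    have wL: "w \<in> L2 \<omega>" "(\<lambda>x. h x $ j) \<in> L2 \<omega>"
      using is_weak_gradient_L2[OF wh] L2_diff[OF vL \<phi>L(1)] by (auto simp: w_def plus_fun_def scaleR_fun_def)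
    have "(LINT x|lebesgue_on \<omega>. w x * partial j \<psi> x) =
        (LINT x|lebesgue_on \<omega>. v x * partial j \<psi> x) - (LINT x|lebesgue_on \<omega>. \<phi> m x * partial j \<psi> x)"
      by (simp add: w_def scaleR_fun_def left_diff_distrib L2_mult_integrable vL \<phi>L \<psi>L)
    moreover have "(LINT x|lebesgue_on \<omega>. h x $ j * \<psi> x) =
        (LINT x|lebesgue_on \<omega>. ?g x $ j * \<psi> x) - (LINT x|lebesgue_on \<omega>. partial j (\<phi> m) x * \<psi> x)"
      by (simp add: h_def classical_gradient_def left_diff_distrib L2_mult_integrable gL \<phi>L \<psi>L)
    ultimately have "E = (LINT x|lebesgue_on \<omega>. w x * partial j \<psi> x) + (LINT x|lebesgue_on \<omega>. h x $ j * \<psi> x)"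
      using test_function_integration_by_parts[OF \<omega>m \<phi>(2)[of m] \<psi>, of j] by (simp add: E_def)
    then have "\<bar>E\<bar> \<le> \<bar>LINT x|lebesgue_on \<omega>. w x * partial j \<psi> x\<bar> + \<bar>LINT x|lebesgue_on \<omega>. h x $ j * \<psi> x\<bar>"
      by simp
    also have "\<dots> \<le> sqrt (LINT x|lebesgue_on \<omega>. (w x)\<^sup>2) * sqrt (LINT x|lebesgue_on \<omega>. (partial j \<psi> x)\<^sup>2)
        + sqrt (LINT x|lebesgue_on \<omega>. (h x $ j)\<^sup>2) * sqrt (LINT x|lebesgue_on \<omega>. (\<psi> x)\<^sup>2)"
      by (intro add_mono L2_Cauchy_Schwarz wL \<psi>L)
    also have "\<dots> \<le> H1_norm \<omega> w * C"
      unfolding C_def distrib_left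
      by (intro add_mono mult_right_mono L2_norms_le_H1_norm[OF \<omega> wh]) auto
    finally show ?thesis by (simp add: w_def)
  qed
  have "(\<lambda>m. H1_norm \<omega> (v - \<phi> m) * C) \<longlonglongrightarrow> 0 * C" by (intro tendsto_intros \<phi>(3))
  then have "\<bar>E\<bar> \<le> 0 * C" using bound by (intro LIMSEQ_le_const) auto
  then show ?thesis by (simp add: E_def)
qed

lemma is_weak_gradient_zero_extension:
  fixes v :: "real ^ 'n \<Rightarrow> real"
  assumes "open \<omega>" "open \<Omega>" "\<omega> \<subseteq> \<Omega>" "v \<in> H10 \<omega>"
  shows "is_weak_gradient \<Omega> (zero_extension \<omega> v) (\<lambda>x. if x \<in> \<omega> then weak_gradient \<omega> v x else 0)"
proof -
  have m: "\<omega> \<in> sets lebesgue" "\<Omega> \<in> sets lebesgue" using assms(1,2) by auto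
  have "v \<in> H1 \<omega>" using assms(4) H10_subset_H1 by blast
  then have gL: "(\<lambda>x. weak_gradient \<omega> v x $ j) \<in> L2 \<omega>" for j
    using H1_D(2) is_weak_gradient_L2 by blast
  have comp: "(\<lambda>x. (if x \<in> \<omega> then weak_gradient \<omega> v x else 0) $ j) =
      zero_extension \<omega> (\<lambda>x. weak_gradient \<omega> v x $ j)" for j
    by (auto simp: zero_extension_def)
  show ?thesis
    unfolding is_weak_gradient_def fun_cong[OF comp] zero_extension_mult
      zero_extension_lebesgue_on(3)[OF m assms(3)]
    using gL H10_integration_by_parts[OF assms(1,4)] L2_zero_extension_iff[OF m assms(3)] by simp
qed

lemma zero_extension_add: "zero_extension \<omega> (v + w) = zero_extension \<omega> v + zero_extension \<omega> w"
  and zero_extension_scaleR: "zero_extension \<omega> (c *\<^sub>R v) = c *\<^sub>R zero_extension \<omega> v"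
  and zero_extension_0: "zero_extension \<omega> 0 = 0"
  by (auto simp: zero_extension_def scaleR_fun_def fun_eq_iff)

lemma H1_norm_zero_extension:
  fixes v :: "real ^ 'n \<Rightarrow> real"
  assumes "open \<omega>" "open \<Omega>" "\<omega> \<subseteq> \<Omega>" "v \<in> H10 \<omega>"
  shows "H1_norm \<Omega> (zero_extension \<omega> v) = H1_norm \<omega> v"
proof -
  have m: "\<omega> \<in> sets lebesgue" "\<Omega> \<in> sets lebesgue" using assms(1,2) by auto
  have "(norm (if x \<in> \<omega> then weak_gradient \<omega> v x else 0))\<^sup>2 =
      zero_extension \<omega> (\<lambda>x. (norm (weak_gradient \<omega> v x))\<^sup>2) x" for x
    by (simp add: zero_extension_def)
  then show ?thesis
    unfolding H1_norm_eq[OF assms(2) is_weak_gradient_zero_extension[OF assms]]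
    unfolding H1_norm_def
    by (simp only: zero_extension_power2 zero_extension_lebesgue_on(3)[OF m assms(3)])
qed

text \<open>Extension by zero preserves weak gradients and hence \<^const>\<open>H1_norm\<close>, and test functions on \<open>\<omega>\<close> are
  test functions on \<open>\<Omega>\<close> equal to their own extension, so approximating sequences carry over.\<close>

lemma local_space_subset_H10:
  fixes \<Omega> \<omega> :: "(real ^ 'n) set"
  assumes "open \<omega>" "open \<Omega>" "\<omega> \<subseteq> \<Omega>"
  shows "local_space \<omega> \<subseteq> H10 \<Omega>"
proof
  fix v assume "v \<in> local_space \<omega>"
  then obtain w where w: "w \<in> H10 \<omega>" "v = zero_extension \<omega> w" by (auto simp: local_space_def)
  obtain \<phi> where \<phi>: "w \<in> H1 \<omega>" "\<And>m. \<phi> m \<in> test_functions \<omega>" "(\<lambda>m. H1_norm \<omega> (w - \<phi> m)) \<longlonglongrightarrow> 0"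
    using H10_E[OF w(1)] by metis
  have m: "\<omega> \<in> sets lebesgue" "\<Omega> \<in> sets lebesgue" using assms(1,2) by auto
  show "v \<in> H10 \<Omega>"
  proof (rule H10_I)
    show "v \<in> H1 \<Omega>"
      using is_weak_gradient_zero_extension[OF assms w(1)] L2_zero_extension_iff[OF m assms(3)] H1_D(1)[OF \<phi>(1)]
      by (auto simp: w(2) H1_def)
    show "\<phi> m \<in> test_functions \<Omega>" for m using \<phi>(2) test_functions_mono[OF assms(3)] by blast
    have "H1_norm \<Omega> (v - \<phi> m) = H1_norm \<omega> (w - \<phi> m)" for m
    proof -
      have "v - \<phi> m = zero_extension \<omega> (w - \<phi> m)"
        using test_function_eq_0[OF \<phi>(2)[of m]] by (auto simp: w(2) zero_extension_def fun_eq_iff)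
      moreover have "w - \<phi> m \<in> H10 \<omega>"
        using w(1) \<phi>(2) test_functions_subset_H10[OF assms(1)]
        by (blast intro: subspace_diff[OF subspace_H10[OF assms(1)]])
      ultimately show ?thesis using H1_norm_zero_extension[OF assms] by simp
    qed
    then show "(\<lambda>m. H1_norm \<Omega> (v - \<phi> m)) \<longlonglongrightarrow> 0" using \<phi>(3) by simp
  qed
qed

lemma subspace_local_space:
  assumes "open \<omega>"
  shows "subspace (local_space \<omega>)"
proof -
  note sub = subspace_H10[OF assms]
  have mem: "zero_extension \<omega> v \<in> local_space \<omega>" if "v \<in> H10 \<omega>" for v
    using that unfolding local_space_def by (rule imageI)
  show ?thesis
  proof (rule subspaceI)
    show "0 \<in> local_space \<omega>"
      using mem[OF subspace_0[OF sub]] unfolding zero_extension_0 .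
  next
    fix v w assume "v \<in> local_space \<omega>" "w \<in> local_space \<omega>"
    then obtain v' w' where "v' \<in> H10 \<omega>" "w' \<in> H10 \<omega>"
      and "v = zero_extension \<omega> v'" "w = zero_extension \<omega> w'"
      unfolding local_space_def by blast
    then show "v + w \<in> local_space \<omega>"
      using mem[OF subspace_add[OF sub, of v' w']] unfolding zero_extension_add by simp
  next
    fix c v assume "v \<in> local_space \<omega>"
    then obtain v' where "v' \<in> H10 \<omega>" "v = zero_extension \<omega> v'"
      unfolding local_space_def by blast
    then show "c *\<^sub>R v \<in> local_space \<omega>"
      using mem[OF subspace_scale[OF sub, of v' c]] unfolding zero_extension_scaleR by simp
  qed
qed

section \<open>The energy form and Galerkin solutions\<close>

lemma energy_form_sym: "energy_form \<Omega> \<kappa> v w = energy_form \<Omega> \<kappa> w v"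
  by (simp add: energy_form_def inner_commute)

lemma energy_integrable:
  assumes \<kappa>: "\<kappa> \<in> borel_measurable (lebesgue_on \<Omega>)"
    and bound: "AE x in lebesgue_on \<Omega>. \<kappa>min \<le> \<kappa> x \<and> \<kappa> x \<le> \<kappa>max" "0 < \<kappa>min"
    and v: "v \<in> H1 \<Omega>" and w: "w \<in> H1 \<Omega>"
  shows "integrable (lebesgue_on \<Omega>) (\<lambda>x. \<kappa> x * (weak_gradient \<Omega> v x \<bullet> weak_gradient \<Omega> w x))"
proof (rule Bochner_Integration.integrable_bound)
  have "integrable (lebesgue_on \<Omega>) (\<lambda>x. weak_gradient \<Omega> v x \<bullet> weak_gradient \<Omega> w x)"
    using H1_D(2)[OF v] H1_D(2)[OF w] by (intro L2_inner_integrable is_weak_gradient_L2)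
  then show "integrable (lebesgue_on \<Omega>) (\<lambda>x. \<kappa>max * (weak_gradient \<Omega> v x \<bullet> weak_gradient \<Omega> w x))"
    and "(\<lambda>x. \<kappa> x * (weak_gradient \<Omega> v x \<bullet> weak_gradient \<Omega> w x)) \<in> borel_measurable (lebesgue_on \<Omega>)"
    using \<kappa> by (auto intro: borel_measurable_times)
  show "AE x in lebesgue_on \<Omega>. norm (\<kappa> x * (weak_gradient \<Omega> v x \<bullet> weak_gradient \<Omega> w x))
      \<le> norm (\<kappa>max * (weak_gradient \<Omega> v x \<bullet> weak_gradient \<Omega> w x))"
    using bound(1) by eventually_elim (use bound(2) in \<open>auto simp: abs_mult intro!: mult_right_mono\<close>)
qed

text \<open>The abstract setting of Galerkin projections. Symmetry is a property of \<open>a\<close> as a whole, the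
  remaining ones are restricted to the subspace \<open>V\<close>, since the energy form is guaranteed to be bilinear
  only on functions that have a weak gradient.\<close>

locale semi_inner_product =
  fixes V :: "'a :: real_vector set" and a :: "'a \<Rightarrow> 'a \<Rightarrow> real"
  assumes subspace_V: "subspace V"
    and sym: "a v w = a w v"
    and add_left: "v \<in> V \<Longrightarrow> v' \<in> V \<Longrightarrow> w \<in> V \<Longrightarrow> a (v + v') w = a v w + a v' w"
    and scale_left: "v \<in> V \<Longrightarrow> w \<in> V \<Longrightarrow> a (c *\<^sub>R v) w = c * a v w"
    and nonneg: "v \<in> V \<Longrightarrow> 0 \<le> a v v"
begin

lemma diff_left: "v \<in> V \<Longrightarrow> v' \<in> V \<Longrightarrow> w \<in> V \<Longrightarrow> a (v - v') w = a v w - a v' w"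
  using add_left[of v "(- 1) *\<^sub>R v'" w] scale_left[of v' w "- 1"] subspace_scale[OF subspace_V, of v' "- 1"]
  by simp

lemma diff_right: "v \<in> V \<Longrightarrow> v' \<in> V \<Longrightarrow> w \<in> V \<Longrightarrow> a w (v - v') = a w v - a w v'"
  using diff_left[of v v' w] sym[of w "v - v'"] sym[of w v] sym[of w v'] by simp

text \<open>The error \<open>u - p\<close> of the Galerkin solution is orthogonal to \<open>W\<close>, in particular to \<open>w - p\<close>.\<close>

lemma Galerkin_pythagoras:
  assumes W: "subspace W" "W \<subseteq> V" and u: "u \<in> V" and p: "p \<in> W"
    and orth: "\<And>\<phi>. \<phi> \<in> W \<Longrightarrow> a p \<phi> = a u \<phi>" and w: "w \<in> W"
  shows "a (u - w) (u - w) = a (u - p) (u - p) + a (w - p) (w - p)"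
proof -
  have V: "p \<in> V" "w \<in> V"
    using W u p w by auto
  then have V: "u - p \<in> V" "w - p \<in> V" "p \<in> V" "w \<in> V"
    using u by (auto intro: subspace_diff[OF subspace_V])
  have "w - p \<in> W" using W(1) p w by (intro subspace_diff)
  then have 0: "a (u - p) (w - p) = 0" using orth[of "w - p"] u V by (simp add: diff_left)
  have "u - w = (u - p) - (w - p)" by simp
  then have "a (u - w) (u - w) = a ((u - p) - (w - p)) ((u - p) - (w - p))" by simp
  also have "\<dots> = a (u - p) (u - p) - 2 * a (u - p) (w - p) + a (w - p) (w - p)"
    using V subspace_diff[OF subspace_V V(1,2)] sym[of "w - p" "u - p"]
    by (simp only: diff_left diff_right) simp
  finally show ?thesis using 0 by simp
qed

lemma Galerkin_best_approximation:
  assumes W: "subspace W" "W \<subseteq> V" and u: "u \<in> V" and p: "p \<in> W"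
    and orth: "\<And>\<phi>. \<phi> \<in> W \<Longrightarrow> a p \<phi> = a u \<phi>" and w: "w \<in> W"
  shows "sqrt (a (u - p) (u - p)) \<le> sqrt (a (u - w) (u - w))"
proof -
  have "w - p \<in> V" using W p w by (auto intro: subspace_diff[OF subspace_V])
  then show ?thesis using Galerkin_pythagoras[OF assms] nonneg by simp
qed

end

text \<open>The chosen gradients are linear in the function only almost everywhere, which is enough under the
  integral; the lower bound on \<open>\<kappa>\<close> gives the sign.\<close>

lemma semi_inner_product_energy_form:
  assumes \<Omega>: "open \<Omega>"
    and \<kappa>: "\<kappa> \<in> borel_measurable (lebesgue_on \<Omega>)"
    and bound: "AE x in lebesgue_on \<Omega>. \<kappa>min \<le> \<kappa> x \<and> \<kappa> x \<le> \<kappa>max" "0 < \<kappa>min"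
  shows "semi_inner_product (H10 \<Omega>) (energy_form \<Omega> \<kappa>)"
proof
  show "subspace (H10 \<Omega>)" by (rule subspace_H10[OF \<Omega>])
  show "energy_form \<Omega> \<kappa> v w = energy_form \<Omega> \<kappa> w v" for v w by (rule energy_form_sym)
  have H1: "v \<in> H10 \<Omega> \<Longrightarrow> v \<in> H1 \<Omega>" for v using H10_subset_H1 by blast
  note int = energy_integrable[OF \<kappa> bound]
  note meas = borel_measurable_integrable[OF int]
  have sub: "subspace (H1 \<Omega>)" by (rule subspace_H1[OF \<Omega>])
  show "energy_form \<Omega> \<kappa> (v + v') w = energy_form \<Omega> \<kappa> v w + energy_form \<Omega> \<kappa> v' w"
    if "v \<in> H10 \<Omega>" "v' \<in> H10 \<Omega>" "w \<in> H10 \<Omega>" for v v' w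
  proof -
    note m = that[THEN H1]
    have "energy_form \<Omega> \<kappa> (v + v') w = (LINT x|lebesgue_on \<Omega>.
        \<kappa> x * (weak_gradient \<Omega> v x \<bullet> weak_gradient \<Omega> w x) + \<kappa> x * (weak_gradient \<Omega> v' x \<bullet> weak_gradient \<Omega> w x))"
      unfolding energy_form_def
    proof (rule integral_cong_AE)
      show "AE x in lebesgue_on \<Omega>. \<kappa> x * (weak_gradient \<Omega> (v + v') x \<bullet> weak_gradient \<Omega> w x) =
          \<kappa> x * (weak_gradient \<Omega> v x \<bullet> weak_gradient \<Omega> w x) + \<kappa> x * (weak_gradient \<Omega> v' x \<bullet> weak_gradient \<Omega> w x)"
        using weak_gradient_add[OF \<Omega> m(1,2)] by eventually_elim (simp add: inner_add_left distrib_left)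
    qed (intro borel_measurable_add meas subspace_add[OF sub] m)+
    then show ?thesis using int m by (simp add: energy_form_def)
  qed
  show "energy_form \<Omega> \<kappa> (c *\<^sub>R v) w = c * energy_form \<Omega> \<kappa> v w"
    if "v \<in> H10 \<Omega>" "w \<in> H10 \<Omega>" for v w c
  proof -
    note m = that[THEN H1]
    have "energy_form \<Omega> \<kappa> (c *\<^sub>R v) w = (LINT x|lebesgue_on \<Omega>.
        c * (\<kappa> x * (weak_gradient \<Omega> v x \<bullet> weak_gradient \<Omega> w x)))"
      unfolding energy_form_def
    proof (rule integral_cong_AE)
      show "AE x in lebesgue_on \<Omega>. \<kappa> x * (weak_gradient \<Omega> (c *\<^sub>R v) x \<bullet> weak_gradient \<Omega> w x) =
          c * (\<kappa> x * (weak_gradient \<Omega> v x \<bullet> weak_gradient \<Omega> w x))"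
        using weak_gradient_scaleR[OF \<Omega> m(1), of c] by eventually_elim simp
    qed (intro borel_measurable_times borel_measurable_const meas subspace_scale[OF sub] m)+
    then show ?thesis by (simp add: energy_form_def)
  qed
  show "0 \<le> energy_form \<Omega> \<kappa> v v" if "v \<in> H10 \<Omega>" for v
    unfolding energy_form_def
    using bound by (intro integral_nonneg_AE) (auto elim!: eventually_mono)
qed

section \<open>The enrichment algorithm\<close>

lemma solves_orthogonal:
  assumes "solves \<Omega> \<kappa> f (H10 \<Omega>) u" "solves \<Omega> \<kappa> f W p" "W \<subseteq> H10 \<Omega>" "\<phi> \<in> W"
  shows "energy_form \<Omega> \<kappa> p \<phi> = energy_form \<Omega> \<kappa> u \<phi>"
  using assms unfolding solves_def by (metis subsetD)

lemma set_plus_subset_subspace: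
  assumes "subspace W" "A \<subseteq> W" "B \<subseteq> W"
  shows "A + B \<subseteq> W"
  using assms subspace_add[OF assms(1)] unfolding set_plus_def by blast

lemma subspace_set_plus:
  assumes "subspace A" "subspace B"
  shows "subspace (A + B)"
proof -
  have "A + B = {x + y |x y. x \<in> A \<and> y \<in> B}" by (auto simp: set_plus_def)
  then show ?thesis using subspace_sums[OF assms] by simp
qed

lemma subset_set_plus:
  fixes A B :: "'a :: real_vector set"
  shows "subspace B \<Longrightarrow> A \<subseteq> A + B" "subspace A \<Longrightarrow> B \<subseteq> A + B"
  using set_plus_intro[of _ A 0 B] set_plus_intro[of 0 A _ B] subspace_0 by auto

lemma online_enrichment_step:
  assumes "online_enrichment \<Omega> \<kappa> f N \<omega> Vt ut"
  obtains uh k where "\<And>i. i \<in> {1..N} \<Longrightarrow> solves \<Omega> \<kappa> f (Vt n + local_space (\<omega> i)) (uh i)"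
    and "k \<in> {1..N}"
    and "\<And>i. i \<in> {1..N} \<Longrightarrow> energy_norm \<Omega> \<kappa> (ut n - uh i) \<le> energy_norm \<Omega> \<kappa> (ut n - uh k)"
    and "Vt (Suc n) = Vt n + span {uh k}"
proof -
  obtain uh k where *: "\<forall>i\<in>{1..N}. solves \<Omega> \<kappa> f (Vt n + local_space (\<omega> i)) (uh i)"
    "k \<in> {1..N}"
    "\<forall>i\<in>{1..N}. energy_norm \<Omega> \<kappa> (ut n - uh i) \<le> energy_norm \<Omega> \<kappa> (ut n - uh k)"
    "Vt (Suc n) = Vt n + span {uh k}"
    using assms unfolding online_enrichment_def by blast
  show thesis by (rule that[of uh k]) (use * in auto)
qed

text \<open>Each enrichment is taken from the sum of the current reduced space and a local space, so all
  reduced spaces stay inside any subspace that contains the local spaces.\<close>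

lemma reduced_space_subspace:
  assumes run: "online_enrichment \<Omega> \<kappa> f N \<omega> Vt ut"
    and V: "subspace V" and local_V: "\<And>i. i \<in> {1..N} \<Longrightarrow> local_space (\<omega> i) \<subseteq> V"
  shows "subspace (Vt n) \<and> Vt n \<subseteq> V"
proof (induction n)
  case 0
  have "Vt 0 = {0}" using run by (simp add: online_enrichment_def)
  then show ?case using V subspace_0 by auto
next
  case (Suc n)
  obtain uh k where uh: "\<And>i. i \<in> {1..N} \<Longrightarrow> solves \<Omega> \<kappa> f (Vt n + local_space (\<omega> i)) (uh i)"
    and k: "k \<in> {1..N}" and Vt: "Vt (Suc n) = Vt n + span {uh k}"
    using online_enrichment_step[OF run, of n] by metis
  have "uh k \<in> Vt n + local_space (\<omega> k)" using uh[OF k] by (simp add: solves_def)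
  moreover have "Vt n + local_space (\<omega> k) \<subseteq> V"
    using Suc local_V[OF k] by (intro set_plus_subset_subspace[OF V]) auto
  ultimately have "span {uh k} \<subseteq> V" using V by (intro span_minimal) auto
  then show ?case
    unfolding Vt using Suc by (auto intro: subspace_set_plus set_plus_subset_subspace[OF V, THEN subsetD])
qed

theorem theorem4:
  fixes \<Omega> :: "(real ^ 'n) set"
    and \<kappa> f u :: "real ^ 'n \<Rightarrow> real"
    and \<kappa>min \<kappa>max :: real
    and N :: nat
    and \<omega> :: "nat \<Rightarrow> (real ^ 'n) set"
    and Vt :: "nat \<Rightarrow> (real ^ 'n \<Rightarrow> real) set"
    and ut :: "nat \<Rightarrow> real ^ 'n \<Rightarrow> real"
    and n :: nat
  assumes "CARD('n) \<in> {2, 3}"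
    and "open \<Omega>" and "connected \<Omega>" and "bounded \<Omega>" and "\<Omega> \<noteq> {}"
    and "\<kappa> \<in> borel_measurable (lebesgue_on \<Omega>)"
    and "0 < \<kappa>min"
    and "AE x in lebesgue_on \<Omega>. \<kappa>min \<le> \<kappa> x \<and> \<kappa> x \<le> \<kappa>max"
    and "f \<in> L2 \<Omega>"
    and "\<And>i. i \<in> {1..N} \<Longrightarrow> open (\<omega> i)"
    and "(\<Union>i\<in>{1..N}. \<omega> i) = \<Omega>"
    and "solves \<Omega> \<kappa> f (H10 \<Omega>) u"
    and "online_enrichment \<Omega> \<kappa> f N \<omega> Vt ut"
  shows "\<exists>m :: nat \<Rightarrow> real.
    (\<forall>i\<in>{1..N}. is_minimum
      {energy_norm \<Omega> \<kappa> (u - ue) | \<psi> ue.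
        \<psi> \<in> local_space (\<omega> i) \<and> solves \<Omega> \<kappa> f (Vt n + span {\<psi>}) ue} (m i)) \<and>
    energy_norm \<Omega> \<kappa> (u - ut (Suc n)) = Min (m ` {1..N})"
proof -
  let ?V = "H10 \<Omega>" and ?a = "energy_form \<Omega> \<kappa>"
  note u = assms(12) and run = assms(13)
  interpret semi_inner_product ?V ?a
    by (rule semi_inner_product_energy_form) (use assms in auto)
  have O: "subspace (local_space (\<omega> i))" "local_space (\<omega> i) \<subseteq> ?V" if "i \<in> {1..N}" for i
  proof -
    have "\<omega> i \<subseteq> \<Omega>" using assms(11) that by blast
    then show "subspace (local_space (\<omega> i))" "local_space (\<omega> i) \<subseteq> ?V"
      using assms(2,10) that subspace_local_space local_space_subset_H10 by blast+
  qed
  have Vt: "subspace (Vt j)" "Vt j \<subseteq> ?V" for j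
    using reduced_space_subspace[OF run subspace_V O(2)] by auto
  define W where "W i = Vt n + local_space (\<omega> i)" for i
  have W: "subspace (W i)" "W i \<subseteq> ?V" if "i \<in> {1..N}" for i
    unfolding W_def using O[OF that] Vt[of n]
    by (blast intro: subspace_set_plus set_plus_subset_subspace[OF subspace_V, THEN subsetD])+
  obtain uh k where uh: "\<And>i. i \<in> {1..N} \<Longrightarrow> solves \<Omega> \<kappa> f (W i) (uh i)"
    and k: "k \<in> {1..N}"
    and kmax: "\<And>i. i \<in> {1..N} \<Longrightarrow> energy_norm \<Omega> \<kappa> (ut n - uh i) \<le> energy_norm \<Omega> \<kappa> (ut n - uh k)"
    and VSuc: "Vt (Suc n) = Vt n + span {uh k}"
    using online_enrichment_step[OF run, of n] unfolding W_def by metis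
  have uV: "u \<in> ?V" using u by (simp add: solves_def)
  have uhW: "uh i \<in> W i" if "i \<in> {1..N}" for i using uh[OF that] by (simp add: solves_def)
  have ut: "solves \<Omega> \<kappa> f (Vt j) (ut j)" for j using run by (simp add: online_enrichment_def)
  then have utV: "ut j \<in> Vt j" for j by (simp add: solves_def)
  have best: "energy_norm \<Omega> \<kappa> (u - p) \<le> energy_norm \<Omega> \<kappa> (u - w)"
    if "subspace X" "X \<subseteq> ?V" "solves \<Omega> \<kappa> f X p" "w \<in> X" for X p w
    unfolding energy_norm_def
    using that solves_orthogonal[OF u that(3,2)]
    by (intro Galerkin_best_approximation[OF that(1,2) uV]) (auto simp: solves_def)
  \<comment> \<open>Enriching by one vector of the local space, or by one vector of \<open>W i\<close>, does not leave \<open>W i\<close>.\<close>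
  have span_sub: "Vt n + span {\<psi>} \<subseteq> W i" if "i \<in> {1..N}" "\<psi> \<in> W i" for i \<psi>
  proof (rule set_plus_subset_subspace[OF W(1)[OF that(1)]])
    show "Vt n \<subseteq> W i" unfolding W_def using O(1)[OF that(1)] by (rule subset_set_plus)
    show "span {\<psi>} \<subseteq> W i" using W(1)[OF that(1)] that(2) by (intro span_minimal) auto
  qed
  define m where "m i = energy_norm \<Omega> \<kappa> (u - uh i)" for i
  have "is_minimum {energy_norm \<Omega> \<kappa> (u - ue) | \<psi> ue.
      \<psi> \<in> local_space (\<omega> i) \<and> solves \<Omega> \<kappa> f (Vt n + span {\<psi>}) ue} (m i)" if i: "i \<in> {1..N}" for i
    unfolding is_minimum_def
  proof (intro conjI ballI)
    \<comment> \<open>The local part of \<open>uh i\<close> is an optimal enrichment: the enlarged space contains \<open>uh i\<close>.\<close>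
    obtain v \<psi> where v: "v \<in> Vt n" "\<psi> \<in> local_space (\<omega> i)" "uh i = v + \<psi>"
      using uhW[OF i] unfolding W_def by (auto elim: set_plus_elim)
    have in_W: "\<psi> \<in> W i" if "\<psi> \<in> local_space (\<omega> i)" for \<psi>
      using subset_set_plus(2)[OF Vt(1)] that unfolding W_def by blast
    have "uh i \<in> Vt n + span {\<psi>}"
      using v by (auto intro: set_plus_intro span_base)
    then have "solves \<Omega> \<kappa> f (Vt n + span {\<psi>}) (uh i)"
      using uh[OF i] span_sub[OF i in_W[OF v(2)]] by (auto simp: solves_def)
    then show "m i \<in> {energy_norm \<Omega> \<kappa> (u - ue) | \<psi> ue.
        \<psi> \<in> local_space (\<omega> i) \<and> solves \<Omega> \<kappa> f (Vt n + span {\<psi>}) ue}"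
      using v(2) unfolding m_def by blast
    fix s assume "s \<in> {energy_norm \<Omega> \<kappa> (u - ue) | \<psi> ue.
        \<psi> \<in> local_space (\<omega> i) \<and> solves \<Omega> \<kappa> f (Vt n + span {\<psi>}) ue}"
    then obtain \<psi>' ue where s: "s = energy_norm \<Omega> \<kappa> (u - ue)" "\<psi>' \<in> local_space (\<omega> i)"
      "solves \<Omega> \<kappa> f (Vt n + span {\<psi>'}) ue" by blast
    then have "ue \<in> W i" using span_sub[OF i in_W[OF s(2)]] by (auto simp: solves_def)
    then show "m i \<le> s" unfolding m_def s(1) by (rule best[OF W[OF i] uh[OF i]])
  qed
  \<comment> \<open>The next reduced space lies between \<open>{uh k}\<close> and \<open>W k\<close>, so both solutions are equally good.\<close>
  moreover have "energy_norm \<Omega> \<kappa> (u - ut (Suc n)) = m k"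
  proof (rule antisym)
    have "uh k \<in> Vt (Suc n)"
      unfolding VSuc using subset_set_plus(2)[OF Vt(1), of "span {uh k}"] span_base[of "uh k"] by blast
    then show "energy_norm \<Omega> \<kappa> (u - ut (Suc n)) \<le> m k"
      unfolding m_def by (rule best[OF Vt ut])
    have "ut (Suc n) \<in> W k" using utV[of "Suc n"] span_sub[OF k uhW[OF k]] unfolding VSuc by blast
    then show "m k \<le> energy_norm \<Omega> \<kappa> (u - ut (Suc n))"
      unfolding m_def by (rule best[OF W[OF k] uh[OF k]])
  qed
  moreover have "Min (m ` {1..N}) = m k"
  proof (rule Min_eqI)
    show "m k \<in> m ` {1..N}" using k by simp
    fix y assume "y \<in> m ` {1..N}"
    then obtain i where i: "i \<in> {1..N}" "y = m i" by blast
    \<comment> \<open>The error of \<open>ut n\<close> splits into the error that remains and the gain; the total is the same for all \<open>i\<close>, so the largest gain leaves the smallest error.\<close>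
    have split: "?a (u - ut n) (u - ut n) = ?a (u - uh i) (u - uh i) + ?a (ut n - uh i) (ut n - uh i)"
      if "i \<in> {1..N}" for i
    proof (rule Galerkin_pythagoras[OF W[OF that] uV uhW[OF that]])
      show "?a (uh i) \<phi> = ?a u \<phi>" if "\<phi> \<in> W i" for \<phi>
        using solves_orthogonal[OF u uh W(2)] that \<open>i \<in> {1..N}\<close> by blast
      show "ut n \<in> W i"
        unfolding W_def using subset_set_plus(1)[OF O(1)[OF that], of "Vt n"] utV[of n] by blast
    qed
    have "?a (ut n - uh i) (ut n - uh i) \<le> ?a (ut n - uh k) (ut n - uh k)"
      using kmax[OF i(1)] by (simp add: energy_norm_def)
    then have "?a (u - uh k) (u - uh k) \<le> ?a (u - uh i) (u - uh i)"
      using split[OF i(1)] split[OF k] by linarith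
    then show "m k \<le> y" unfolding i(2) m_def energy_norm_def by (rule real_sqrt_le_mono)
  qed simp
  ultimately show ?thesis by (intro exI[of _ m]) simp
qed

end
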